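(* Let $(A,\mathbf{B})$ be a non-real bipartite rank $6$ table algebra with $\mathbf{N}=\ker\phi=\{b_0,b_4,b_5\}$, and let $\delta_i=\delta(b_i)$. Then $(A,\mathbf{B})$ is integral if and only if there are odd positive integers $\alpha,\gamma,k_1,k_2$ such that $$\delta_1=\alpha\gamma k_1,\quad \delta_2=\alpha\gamma k_2,\quad \delta_3=\alpha^2k_1k_2,\quad \gcd(k_1,k_2)=1,\quad \alpha^2<2\gamma,$$ and $\delta_4$ divides each of $$\gamma k_1k_2,\quad \gamma k_1(\alpha\gamma k_1-1),\quad \gamma k_2(\alpha\gamma k_2-1),\quad k_1k_2(\alpha^2k_1k_2-1).$$
   Context: A reality-based algebra (RBA) $(A,\mathbf{B})$ of rank $r$ is a finite-dimensional $\mathbb{C}$-algebra $A$ with conjugate-semilinear involution $*$ ($(\alpha x)^*=\bar\alpha x^*$, $(xy)^*=y^*x^*$) and a distinguished basis $\mathbf{B}=\{b_0,\dots,b_{r-1}\}$ such that: (1) $b_0=1_A$; (2) the structure constants $\lambda_{ijk}$ in $b_ib_j=\sum_k\lambda_{ijk}b_k$ are real; (3) $\mathbf{B}^*=\mathbf{B}$, and one writes $b_{i^*}=(b_i)^*$; (4) $\lambda_{ij0}\ne0$ if and only if $j=i^*$; (5) $\lambda_{ii^*0}=\lambda_{i^*i0}>0$. A positive degree map is a one-dimensional algebra homomorphism $\delta:A\to\mathbb{C}$ with $\delta(a^* )=\overline{\delta(a)}$ and $\delta(b_i)>0$ for all $i$. The basis is standard if $\delta(b_i)=\lambda_{ii^*0}$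 for all $i$. A table algebra is an RBA whose structure constants are all nonnegative; it is integral if all structure constants with respect to its standard basis are integers. A noncommutative rank $6$ table algebra with positive degree map $\delta$ and standard basis $\mathbf{B}$ has irreducible characters $\delta$, a second linear character $\phi$, and $\chi$ of degree $2$; the basis is labelled so that $b_i^*=b_i$ for $i=1,2,3$ and $b_4^*=b_5$. Write $n=\sum_i\delta(b_i)$; the standard feasible trace $\tau(\sum_i\alpha_ib_i)=n\alpha_0$ equals $\delta+m_\phi\phi+m_\chi\chi$, where $m_\phi,m_\chi>0$ are the multiplicities. The kernel is $\ker\phi=\{b_i\in\mathbf{B}:\phi(b_i)=\delta(b_i)\}$. A non-real bipartite rank $6$ table algebra is a noncommutative rank $6$ table algebra (with standard basis) with $m_\phi=1$ and $\ker\phi=\{b_0,b_4,b_5\}$. *)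

theory Defs
  imports "HOL-Analysis.Analysis"
begin

locale complex_algebra =
  vector_space scale for scale :: "complex \<Rightarrow> 'a::ring_1 \<Rightarrow> 'a" (infixr "*\<^sub>A" 75) +
  assumes scale_mult_left: "(c *\<^sub>A x) * y = c *\<^sub>A (x * y)"
    and scale_mult_right: "x * (c *\<^sub>A y) = c *\<^sub>A (x * y)"
begin

definition linear_character :: "('a \<Rightarrow> complex) \<Rightarrow> bool" where
  "linear_character \<psi> \<longleftrightarrow>
     (\<forall>x y. \<psi> (x + y) = \<psi> x + \<psi> y) \<and> (\<forall>c x. \<psi> (c *\<^sub>A x) = c * \<psi> x) \<and>
     (\<forall>x y. \<psi> (x * y) = \<psi> x * \<psi> y) \<and> \<psi> 1 = 1"

definition matrix_representation :: "('a \<Rightarrow> complex^'d^'d) \<Rightarrow> bool" where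
  "matrix_representation \<rho> \<longleftrightarrow>
     (\<forall>x y. \<rho> (x + y) = \<rho> x + \<rho> y) \<and> (\<forall>c x. \<rho> (c *\<^sub>A x) = mat c ** \<rho> x) \<and>
     (\<forall>x y. \<rho> (x * y) = \<rho> x ** \<rho> y) \<and> \<rho> 1 = mat 1"

definition irreducible_representation :: "('a \<Rightarrow> complex^'d^'d) \<Rightarrow> bool" where
  "irreducible_representation \<rho> \<longleftrightarrow> matrix_representation \<rho> \<and>
     (\<forall>W. vec.subspace W \<and> (\<forall>x. \<forall>v\<in>W. \<rho> x *v v \<in> W) \<longrightarrow> W = {0} \<or> W = UNIV)"

definition irreducible_character_degree_2 :: "('a \<Rightarrow> complex) \<Rightarrow> bool" where
  "irreducible_character_degree_2 \<xi> \<longleftrightarrow>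
     (\<exists>\<rho> :: 'a \<Rightarrow> complex^2^2. irreducible_representation \<rho> \<and> \<xi> = (\<lambda>x. trace (\<rho> x)))"

end

locale based_algebra = complex_algebra scale
  for scale :: "complex \<Rightarrow> 'a::ring_1 \<Rightarrow> 'a" (infixr "*\<^sub>A" 75) +
  fixes r :: nat and b :: "nat \<Rightarrow> 'a"
  assumes rank_pos: "0 < r"
    and inj_b: "inj_on b {..<r}"
    and independent_b: "independent (b ` {..<r})"
    and span_b: "span (b ` {..<r}) = UNIV"
begin

definition coefficient :: "'a \<Rightarrow> nat \<Rightarrow> complex" where
  "coefficient x k = representation (b ` {..<r}) x (b k)"

definition structure_constant :: "nat \<Rightarrow> nat \<Rightarrow> nat \<Rightarrow> complex" where
  "structure_constant i j k = coefficient (b i * b j) k"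

definition integral_structure :: bool where
  "integral_structure \<longleftrightarrow> (\<forall>i<r. \<forall>j<r. \<forall>k<r. structure_constant i j k \<in> \<int>)"

end

locale reality_based_algebra = based_algebra scale r b
  for scale :: "complex \<Rightarrow> 'a::ring_1 \<Rightarrow> 'a" (infixr "*\<^sub>A" 75)
    and r :: nat and b :: "nat \<Rightarrow> 'a" +
  fixes star :: "'a \<Rightarrow> 'a"
  assumes star_add: "star (x + y) = star x + star y"
    and star_scale: "star (c *\<^sub>A x) = cnj c *\<^sub>A star x"
    and star_mult: "star (x * y) = star y * star x"
    and star_star: "star (star x) = x"
    and b_0: "b 0 = 1"
    and structure_constant_real:
      "\<lbrakk>i < r; j < r; k < r\<rbrakk> \<Longrightarrow> structure_constant i j k \<in> \<real>"
    and star_basis: "star ` b ` {..<r} = b ` {..<r}"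
    (* below, b j = star (b i) expresses that j is the index i* *)
    and structure_constant_0_iff:
      "\<lbrakk>i < r; j < r\<rbrakk> \<Longrightarrow> structure_constant i j 0 \<noteq> 0 \<longleftrightarrow> b j = star (b i)"
    and structure_constant_0_sym:
      "\<lbrakk>i < r; j < r; b j = star (b i)\<rbrakk> \<Longrightarrow> structure_constant i j 0 = structure_constant j i 0"
    and structure_constant_0_pos:
      "\<lbrakk>i < r; j < r; b j = star (b i)\<rbrakk> \<Longrightarrow> 0 < Re (structure_constant i j 0)"
begin

definition positive_degree_map :: "('a \<Rightarrow> complex) \<Rightarrow> bool" where
  "positive_degree_map \<delta> \<longleftrightarrow> linear_character \<delta> \<and> (\<forall>x. \<delta> (star x) = cnj (\<delta> x)) \<and>
     (\<forall>i<r. \<delta> (b i) \<in> \<real> \<and> 0 < Re (\<delta> (b i)))"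

definition standard_basis :: "('a \<Rightarrow> complex) \<Rightarrow> bool" where
  "standard_basis \<delta> \<longleftrightarrow>
     (\<forall>i<r. \<forall>j<r. b j = star (b i) \<longrightarrow> \<delta> (b i) = structure_constant i j 0)"

definition standard_trace :: "('a \<Rightarrow> complex) \<Rightarrow> 'a \<Rightarrow> complex" where
  "standard_trace \<delta> x = (\<Sum>i<r. \<delta> (b i)) * coefficient x 0"

definition kernel :: "('a \<Rightarrow> complex) \<Rightarrow> ('a \<Rightarrow> complex) \<Rightarrow> 'a set" where
  "kernel \<delta> \<psi> = {b i |i. i < r \<and> \<psi> (b i) = \<delta> (b i)}"

end

locale table_algebra = reality_based_algebra scale r b star
  for scale :: "complex \<Rightarrow> 'a::ring_1 \<Rightarrow> 'a" (infixr "*\<^sub>A" 75)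
    and r :: nat and b :: "nat \<Rightarrow> 'a" and star :: "'a \<Rightarrow> 'a" +
  assumes structure_constant_nonneg:
    "\<lbrakk>i < r; j < r; k < r\<rbrakk> \<Longrightarrow> 0 \<le> Re (structure_constant i j k)"

(* \<xi> is the irreducible character of degree 2, usually written chi, which is a binder
   here. The characters and their multiplicities are parameters; the
   algebra and its basis determine all of them. *)
locale noncommutative_rank_6_table_algebra = table_algebra scale 6 b star
  for scale :: "complex \<Rightarrow> 'a::ring_1 \<Rightarrow> 'a" (infixr "*\<^sub>A" 75)
    and b :: "nat \<Rightarrow> 'a" and star :: "'a \<Rightarrow> 'a" +
  fixes \<delta> \<phi> \<xi> :: "'a \<Rightarrow> complex" and m\<^sub>\<phi> m\<^sub>\<xi> :: real
  assumes noncommutative: "\<exists>x y :: 'a. x * y \<noteq> y * x"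
    and degree_map: "positive_degree_map \<delta>"
    and standard: "standard_basis \<delta>"
    and phi: "linear_character \<phi>" "\<phi> \<noteq> \<delta>"
    and chi: "irreducible_character_degree_2 \<xi>"
    and multiplicities_pos: "0 < m\<^sub>\<phi>" "0 < m\<^sub>\<xi>"
    and trace_decomposition:
      "standard_trace \<delta> x = \<delta> x + of_real m\<^sub>\<phi> * \<phi> x + of_real m\<^sub>\<xi> * \<xi> x"
    and symmetric_elements: "star (b 1) = b 1" "star (b 2) = b 2" "star (b 3) = b 3"
    and nonsymmetric_elements: "star (b 4) = b 5"

locale nonreal_bipartite_rank_6 =
  noncommutative_rank_6_table_algebra scale b star \<delta> \<phi> \<xi> m\<^sub>\<phi> m\<^sub>\<xi>
  for scale :: "complex \<Rightarrow> 'a::ring_1 \<Rightarrow> 'a" (infixr "*\<^sub>A" 75)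
    and b :: "nat \<Rightarrow> 'a" and star :: "'a \<Rightarrow> 'a"
    and \<delta> \<phi> \<xi> :: "'a \<Rightarrow> complex" and m\<^sub>\<phi> m\<^sub>\<xi> :: real +
  assumes multiplicity_phi: "m\<^sub>\<phi> = 1"
    and kernel_phi: "kernel \<delta> \<phi> = {b 0, b 4, b 5}"

end

theory Submission
  imports Defs
begin

text \<open>Everything is read off the numbers \<open>T i j k\<close>, the coefficient of \<open>b 0\<close> in
  \<open>b i * b j * b k\<close>, which are cyclically symmetric and satisfy
  \<open>structure_constant i j k = T i j k' / \<delta> (b k)\<close> with \<open>b k' = star (b k)\<close>.
  Since \<open>|\<phi>| \<le> \<delta>\<close> on the basis, the kernel is closed; a trace comparison shows that the
  degree 2 representation kills \<open>b 0 + b 4 + b 5\<close>, so \<open>\<phi> = - \<delta>\<close> on \<open>b 1, b 2, b 3\<close> and the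
  algebra is graded by parity. The trace formula then determines all \<open>T i j k\<close> from the degrees
  and one number \<open>u\<close>, for which associativity gives \<open>u\<^sup>2 = \<delta>\<^sub>1 \<delta>\<^sub>2 \<delta>\<^sub>3\<close>.
  Integrality makes \<open>p = |u| / \<delta>\<^sub>2\<close>, \<open>q = |u| / \<delta>\<^sub>1\<close>, \<open>w = |u| / \<delta>\<^sub>3\<close> odd integers with
  \<open>\<delta>\<^sub>1 = p w\<close>, \<open>\<delta>\<^sub>2 = q w\<close>, \<open>\<delta>\<^sub>3 = p q\<close>, and the parameters are \<open>\<alpha> = gcd p q\<close>, \<open>\<gamma> = w\<close>,
  \<open>k\<^sub>1 = p / \<alpha>\<close>, \<open>k\<^sub>2 = q / \<alpha>\<close>. Here \<open>\<alpha>\<close> divides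
  \<open>\<delta>\<^sub>1 + \<delta>\<^sub>2 + \<delta>\<^sub>3 = 1 + 2 \<delta>\<^sub>4\<close>, so it is coprime to \<open>\<delta>\<^sub>4\<close> and cancels from the
  divisibility conditions.\<close>

section \<open>Coefficients and characters\<close>

context based_algebra
begin

lemma basis_expansion: "x = (\<Sum>k<r. coefficient x k *\<^sub>A b k)"
proof -
  have "(\<Sum>v\<in>b ` {..<r}. representation (b ` {..<r}) x v *\<^sub>A v) = x"
    by (rule sum_representation_eq[OF independent_b]) (auto simp: span_b)
  then show ?thesis
    by (simp add: sum.reindex[OF inj_b] coefficient_def)
qed

lemma coefficient_add: "coefficient (x + y) k = coefficient x k + coefficient y k"
  by (simp add: coefficient_def representation_add[OF independent_b] span_b)

lemma coefficient_scale: "coefficient (c *\<^sub>A x) k = c * coefficient x k"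
  by (simp add: coefficient_def representation_scale[OF independent_b] span_b)

lemma coefficient_basis:
  assumes "i < r" "k < r"
  shows "coefficient (b i) k = (if i = k then 1 else 0)"
proof -
  have "b k = b i \<longleftrightarrow> i = k"
    using assms inj_b by (auto simp: inj_on_def)
  then show ?thesis
    using assms by (simp add: coefficient_def representation_basis[OF independent_b])
qed

text \<open>Reduces identities between linear functionals, such as
  \<open>x \<mapsto> coefficient (x * y) 0\<close>, to basis elements.\<close>

lemma functional_expansion:
  fixes f :: "'a \<Rightarrow> complex"
  assumes add: "\<And>x y. f (x + y) = f x + f y" and scale: "\<And>c x. f (c *\<^sub>A x) = c * f x"
  shows "f x = (\<Sum>k<r. coefficient x k * f (b k))"
proof -
  have zero: "f 0 = 0"
    using add[of 0 0] by simp
  have "f (\<Sum>k\<in>K. coefficient x k *\<^sub>A b k) = (\<Sum>k\<in>K. coefficient x k * f (b k))" if "finite K" for K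
    using that by induction (simp_all add: add scale zero)
  then show ?thesis
    using basis_expansion[of x] by (metis finite_lessThan)
qed

lemma linear_character_expansion:
  assumes "linear_character \<psi>"
  shows "\<psi> x = (\<Sum>k<r. coefficient x k * \<psi> (b k))"
  using assms by (intro functional_expansion) (auto simp: linear_character_def)

end

section \<open>The trace \<open>coefficient _ 0\<close> and its Hermitian form\<close>

context reality_based_algebra
begin

lemma star_index:
  assumes "i < r" obtains j where "j < r" "b j = star (b i)"
proof -
  have "star (b i) \<in> b ` {..<r}"
    using star_basis assms by blast
  then show ?thesis
    using that by auto
qed

text \<open>On basis elements both sides vanish unless \<open>b j = star (b i)\<close>, and then
  axiom (5) equates them. Bilinearity does the rest, one factor at a time.\<close>

lemma coefficient_0_commute: "coefficient (x * y) 0 = coefficient (y * x) 0"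
proof -
  have basis: "coefficient (b i * b j) 0 = coefficient (b j * b i) 0" if "i < r" "j < r" for i j
  proof (cases "b j = star (b i)")
    case True
    then show ?thesis
      using structure_constant_0_sym[OF that] by (simp add: structure_constant_def)
  next
    case False
    then have "b i \<noteq> star (b j)"
      using star_star by metis
    then show ?thesis
      using False structure_constant_0_iff[OF that] structure_constant_0_iff[OF that(2,1)]
      by (simp add: structure_constant_def)
  qed
  have right: "coefficient (z * b i) 0 = coefficient (b i * z) 0" if "i < r" for z i
    using functional_expansion[of "\<lambda>z. coefficient (z * b i) 0" z]
      functional_expansion[of "\<lambda>z. coefficient (b i * z) 0" z] basis[OF _ that]
    by (simp add: distrib_left distrib_right coefficient_add coefficient_scale
        scale_mult_left scale_mult_right)
  show ?thesis
    using functional_expansion[of "\<lambda>y. coefficient (x * y) 0" y]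
      functional_expansion[of "\<lambda>y. coefficient (y * x) 0" y] right
    by (simp add: distrib_left distrib_right coefficient_add coefficient_scale
        scale_mult_left scale_mult_right)
qed

lemma star_one: "star 1 = 1"
  by (metis mult.left_neutral mult.right_neutral star_mult star_star)

text \<open>\<open>star\<close> permutes the basis and fixes \<open>b 0 = 1\<close>.\<close>

lemma coefficient_0_star: "coefficient (star x) 0 = cnj (coefficient x 0)"
proof -
  have basis: "coefficient (star (b k)) 0 = (if k = 0 then 1 else 0)" if k: "k < r" for k
  proof -
    obtain j where j: "j < r" "b j = star (b k)"
      using star_index[OF k] .
    have "j = 0 \<longleftrightarrow> k = 0"
      by (metis b_0 inj_b inj_onD j k lessThan_iff rank_pos star_one star_star)
    then show ?thesis
      using coefficient_basis[OF j(1) rank_pos] j by simp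
  qed
  \<comment> \<open>The outer \<open>cnj\<close> makes the semilinear map linear, so that
    \<open>functional_expansion\<close> applies.\<close>
  have "cnj (coefficient (star x) 0) = (\<Sum>k<r. coefficient x k * cnj (coefficient (star (b k)) 0))"
    by (intro functional_expansion) (simp_all add: star_add star_scale coefficient_add coefficient_scale)
  also have "\<dots> = (\<Sum>k<r. if k = 0 then coefficient x k else 0)"
    by (intro sum.cong) (auto simp: basis)
  also have "\<dots> = coefficient x 0"
    using rank_pos by simp
  finally show ?thesis
    by (metis complex_cnj_cnj)
qed

text \<open>The basis is orthogonal for the form \<open>coefficient (x * star y) 0\<close>, and in a
  standard basis \<open>b k\<close> has squared length \<open>\<delta> (b k)\<close>.\<close>

lemma coefficient_times_degree:
  assumes "standard_basis \<delta>" "k < r"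
  shows "coefficient (x * star (b k)) 0 = coefficient x k * \<delta> (b k)"
proof -
  obtain j where j: "j < r" "b j = star (b k)"
    using star_index[OF assms(2)] .
  have "coefficient (b i * star (b k)) 0 = (if i = k then \<delta> (b k) else 0)" if i: "i < r" for i
  proof -
    have "b j = star (b i) \<longleftrightarrow> i = k"
      by (metis assms(2) i inj_b inj_onD j(2) lessThan_iff star_star)
    then show ?thesis
      using structure_constant_0_iff[OF i j(1)] assms j
      by (auto simp: structure_constant_def standard_basis_def)
  qed
  then have "(\<Sum>i<r. coefficient x i * coefficient (b i * star (b k)) 0)
      = (\<Sum>i<r. if i = k then coefficient x i * \<delta> (b k) else 0)"
    by (intro sum.cong) auto
  also have "\<dots> = coefficient x k * \<delta> (b k)"
    using assms by simp
  finally show ?thesis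
    using functional_expansion[of "\<lambda>x. coefficient (x * star (b k)) 0" x]
    by (simp add: distrib_right coefficient_add coefficient_scale scale_mult_left)
qed

end

section \<open>Domination of linear characters by the degree map\<close>

context table_algebra
begin

lemma structure_constant_eq_Re:
  assumes "i < r" "j < r" "k < r"
  shows "structure_constant i j k = of_real (Re (structure_constant i j k))"
  using structure_constant_real[OF assms] by simp

lemma degree_eq_Re:
  assumes "positive_degree_map \<delta>" "i < r"
  shows "\<delta> (b i) = of_real (Re (\<delta> (b i)))"
  using assms by (simp add: positive_degree_map_def)

lemma character_product:
  assumes "linear_character \<psi>"
  shows "\<psi> (b i) * \<psi> (b j) = (\<Sum>k<r. structure_constant i j k * \<psi> (b k))"
  using linear_character_expansion[OF assms, of "b i * b j"] assms
  by (simp add: linear_character_def structure_constant_def)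

lemma degree_product:
  assumes "positive_degree_map \<delta>" "i < r" "j < r"
  shows "Re (\<delta> (b i)) * Re (\<delta> (b j)) = (\<Sum>k<r. Re (structure_constant i j k) * Re (\<delta> (b k)))"
proof -
  have im: "Im (\<delta> (b k)) = 0" if "k < r" for k
    using degree_eq_Re[OF assms(1) that] by (metis Im_complex_of_real)
  have "Re (\<delta> (b i) * \<delta> (b j)) = (\<Sum>k<r. Re (structure_constant i j k * \<delta> (b k)))"
    using character_product[of \<delta> i j] assms(1) by (simp add: positive_degree_map_def)
  then show ?thesis
    using im assms(2) by simp
qed

text \<open>A maximum argument: if the ratio of \<open>cmod (\<psi> (b k))\<close> to the degree is
  largest at \<open>m\<close> with value \<open>M\<close>, expanding \<open>b m * b m\<close> with
  nonnegative constants gives \<open>M * M \<le> M\<close>.\<close>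

lemma character_bound:
  assumes \<delta>: "positive_degree_map \<delta>" and \<psi>: "linear_character \<psi>" and i: "i < r"
  shows "cmod (\<psi> (b i)) \<le> Re (\<delta> (b i))"
proof -
  define q where "q k = cmod (\<psi> (b k)) / Re (\<delta> (b k))" for k
  have pos: "0 < Re (\<delta> (b k))" if "k < r" for k
    using \<delta> that by (simp add: positive_degree_map_def)
  define M where "M = Max (q ` {..<r})"
  have "M \<in> q ` {..<r}"
    unfolding M_def using i by (intro Max_in) auto
  then obtain m where m: "m < r" "M = q m"
    by auto
  have le: "cmod (\<psi> (b k)) \<le> M * Re (\<delta> (b k))" if "k < r" for k
  proof -
    have "q k \<le> M"
      unfolding M_def using that by (intro Max_ge) auto
    then show ?thesis
      using pos[OF that] by (simp add: q_def field_simps)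
  qed
  have eq: "cmod (\<psi> (b m)) = M * Re (\<delta> (b m))"
    using pos[OF m(1)] by (simp add: m(2) q_def)
  have "cmod (\<psi> (b m)) * cmod (\<psi> (b m)) \<le> (\<Sum>k<r. cmod (structure_constant m m k * \<psi> (b k)))"
    by (metis character_product[OF \<psi>] norm_mult norm_sum)
  also have "\<dots> \<le> (\<Sum>k<r. M * (Re (structure_constant m m k) * Re (\<delta> (b k))))"
  proof (intro sum_mono)
    fix k assume k: "k \<in> {..<r}"
    then have "cmod (structure_constant m m k) = Re (structure_constant m m k)"
      using structure_constant_nonneg structure_constant_eq_Re m(1)
      by (metis abs_of_nonneg lessThan_iff norm_of_real)
    then show "cmod (structure_constant m m k * \<psi> (b k))
        \<le> M * (Re (structure_constant m m k) * Re (\<delta> (b k)))"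
      using mult_left_mono[OF le[of k], of "Re (structure_constant m m k)"] k
        structure_constant_nonneg[OF m(1) m(1), of k]
      by (simp add: norm_mult mult.left_commute)
  qed
  also have "\<dots> = M * (Re (\<delta> (b m)) * Re (\<delta> (b m)))"
    by (simp add: degree_product[OF \<delta> m(1) m(1)] sum_distrib_left)
  finally have "M * M * (Re (\<delta> (b m)))\<^sup>2 \<le> M * (Re (\<delta> (b m)))\<^sup>2"
    by (simp add: eq power2_eq_square mult_ac)
  then have "M * M \<le> M"
    by (rule mult_right_le_imp_le) (use pos[OF m(1)] in simp)
  moreover have "M * 1 < M * M" if "1 < M"
    by (rule mult_strict_left_mono) (use that in auto)
  ultimately have "M \<le> 1"
    by linarith
  then show ?thesis
    using le[OF i] pos[OF i] mult_right_mono[of M 1 "Re (\<delta> (b i))"] by linarith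
qed

text \<open>The coefficients being nonnegative, equality in the triangle inequality for
  \<open>\<psi> (b i * b j)\<close> forces every contributing basis element into the kernel.\<close>

lemma structure_constant_eq_0:
  assumes \<delta>: "positive_degree_map \<delta>" and \<psi>: "linear_character \<psi>"
    and i: "i < r" and j: "j < r" and k: "k < r"
    and eq: "\<psi> (b i) * \<psi> (b j) = \<delta> (b i) * \<delta> (b j)" and ne: "\<psi> (b k) \<noteq> \<delta> (b k)"
  shows "structure_constant i j k = 0"
proof -
  define g where "g l = Re (structure_constant i j l) * (Re (\<delta> (b l)) - Re (\<psi> (b l)))" for l
  have le: "Re (\<psi> (b l)) \<le> Re (\<delta> (b l))" if "l < r" for l
    using character_bound[OF \<delta> \<psi> that] complex_Re_le_cmod order_trans by blast
  have nonneg: "0 \<le> g l" if "l < r" for l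
    using le[OF that] structure_constant_nonneg[OF i j that] by (simp add: g_def)
  have char: "linear_character \<delta>"
    using \<delta> by (simp add: positive_degree_map_def)
  have "(\<Sum>l<r. structure_constant i j l * (\<delta> (b l) - \<psi> (b l))) = 0"
    using eq character_product[OF \<psi>, of i j] character_product[OF char, of i j]
    by (simp add: right_diff_distrib sum_subtractf)
  then have "(\<Sum>l<r. Re (structure_constant i j l * (\<delta> (b l) - \<psi> (b l)))) = 0"
    by (metis Re_sum zero_complex.sel(1))
  moreover have "Re (structure_constant i j l * (\<delta> (b l) - \<psi> (b l))) = g l" if "l < r" for l
    using structure_constant_eq_Re[OF i j that] unfolding g_def
    by (metis Im_complex_of_real diff_zero minus_complex.sel(1) mult_zero_left times_complex.sel(1))
  ultimately have "(\<Sum>l<r. g l) = 0"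
    by simp
  then have "g k = 0"
    using sum_nonneg_eq_0_iff[of "{..<r}" g] nonneg k by auto
  \<comment> \<open>\<open>g\<close> sees only real parts. If these agreed,
    \<open>character_bound\<close> would leave no room for an imaginary part, contradicting
    \<open>ne\<close>.\<close>
  moreover have "Re (\<psi> (b k)) \<noteq> Re (\<delta> (b k))"
  proof
    assume eq: "Re (\<psi> (b k)) = Re (\<delta> (b k))"
    then have "(Re (\<psi> (b k)))\<^sup>2 + (Im (\<psi> (b k)))\<^sup>2 \<le> (Re (\<psi> (b k)))\<^sup>2"
      using character_bound[OF \<delta> \<psi> k] power_mono[of "cmod (\<psi> (b k))" _ 2]
      by (metis cmod_power2 norm_ge_zero)
    then have "Im (\<psi> (b k)) = 0"
      by simp
    then show False
      using ne eq degree_eq_Re[OF \<delta> k] by (metis Im_complex_of_real complex_eqI)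
  qed
  ultimately show ?thesis
    using structure_constant_eq_Re[OF i j k] by (simp add: g_def)
qed

end


text \<open>For \<open>c \<noteq> 0\<close> the matrix is \<open>c\<close> times an idempotent,
  whose trace is its rank 0, 1 or 2; for \<open>c = 0\<close> it is nilpotent.\<close>

lemma square_matrix_2_cases:
  fixes M :: "complex^2^2"
  assumes "M ** M = mat c ** M"
  shows "trace M \<in> {0, c, 2 * c}" and "c \<noteq> 0 \<Longrightarrow> trace M = 0 \<Longrightarrow> M = 0"
proof -
  define p q s t where "p = M$1$1" "q = M$1$2" "s = M$2$1" "t = M$2$2"
  note entries = this
  have "p * p + q * s = c * p" "p * q + q * t = c * q" "s * p + t * s = c * s" "s * q + t * t = c * t"
    using assms by (simp_all add: vec_eq_iff forall_2 matrix_matrix_mult_def sum_2 mat_def entries)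
  note eqs = this
  have trace: "trace M = p + t"
    by (simp add: trace_def sum_2 entries)
  have "(p + t) * (p + t - c) * (p + t - 2 * c) = 0"
    using eqs by algebra
  then show "trace M \<in> {0, c, 2 * c}"
    by (auto simp: trace)
  assume c: "c \<noteq> 0" and "trace M = 0"
  then have t: "t = - p"
    by (simp add: trace add_eq_0_iff)
  have "c * q = 0" "c * s = 0" "c * p = 0"
    using eqs t by algebra+
  then show "M = 0"
    using c t by (simp add: vec_eq_iff forall_2 flip: entries)
qed

section \<open>Triple coefficients in rank 6\<close>

lemma sum_lessThan_6: "(\<Sum>k<6. f k) = f 0 + f 1 + f 2 + f 3 + f 4 + f (5::nat)"
  by (simp add: eval_nat_numeral)

context noncommutative_rank_6_table_algebra
begin

text \<open>The index \<open>i*\<close> of the involution. Indices from 6 on are fixed, so that it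
  is an involution everywhere.\<close>

definition conj_index :: "nat \<Rightarrow> nat" where
  "conj_index i = (if i = 4 then 5 else if i = 5 then 4 else i)"

definition deg :: "nat \<Rightarrow> real" where
  "deg i = Re (\<delta> (b i))"

text \<open>Unlike the structure constants, these are invariant under cyclic shifts.\<close>

definition triple :: "nat \<Rightarrow> nat \<Rightarrow> nat \<Rightarrow> real" where
  "triple i j k = Re (coefficient (b i * b j * b k) 0)"

lemma conj_index_less: "i < 6 \<Longrightarrow> conj_index i < 6"
  by (simp add: conj_index_def)

lemma conj_index_conj_index: "conj_index (conj_index i) = i"
  by (simp add: conj_index_def)

lemma star_b: "i < 6 \<Longrightarrow> star (b i) = b (conj_index i)"
proof -
  assume "i < 6"
  then consider "i = 0" | "i = 1" | "i = 2" | "i = 3" | "i = 4" | "i = 5"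
    by linarith
  then show ?thesis
    using symmetric_elements nonsymmetric_elements star_star[of "b 4"] star_one b_0
    by cases (simp_all add: conj_index_def)
qed

lemma character_degree: "linear_character \<delta>"
  using degree_map by (simp add: positive_degree_map_def)

lemma degree_eq_deg: "i < 6 \<Longrightarrow> \<delta> (b i) = of_real (deg i)"
  using degree_eq_Re[OF degree_map] by (simp add: deg_def)

lemma deg_pos: "i < 6 \<Longrightarrow> 0 < deg i"
  using degree_map by (simp add: positive_degree_map_def deg_def)

lemma deg_0: "deg 0 = 1"
  using character_degree b_0 by (simp add: deg_def linear_character_def)

lemma deg_5: "deg 5 = deg 4"
  using degree_map nonsymmetric_elements by (metis cnj.sel(1) deg_def positive_degree_map_def)

lemma deg_conj_index: "deg (conj_index i) = deg i"
  by (simp add: conj_index_def deg_5)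

lemma coefficient_times_deg:
  "k < 6 \<Longrightarrow> coefficient x k * of_real (deg k) = coefficient (x * b (conj_index k)) 0"
  using coefficient_times_degree[OF standard, of k x] by (simp add: star_b degree_eq_deg)

lemma structure_constant_triple:
  assumes "i < 6" "j < 6" "k < 6"
  shows "structure_constant i j k = of_real (triple i j (conj_index k) / deg k)"
proof -
  have "structure_constant i j k * of_real (deg k) = coefficient (b i * b j * b (conj_index k)) 0"
    using coefficient_times_deg[OF assms(3)] by (simp add: structure_constant_def)
  then have "Re (structure_constant i j k) * deg k = triple i j (conj_index k)"
    unfolding triple_def by (metis Im_complex_of_real Re_complex_of_real diff_zero mult_zero_right times_complex.sel(1))
  then have "Re (structure_constant i j k) = triple i j (conj_index k) / deg k"
    using deg_pos[OF assms(3)] by (simp add: field_simps)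
  then show ?thesis
    using structure_constant_eq_Re[OF assms] by simp
qed

lemma coefficient_triple:
  assumes "i < 6" "j < 6" "k < 6"
  shows "coefficient (b i * b j * b k) 0 = of_real (triple i j k)"
proof -
  have "coefficient (b i * b j * b k) 0
      = structure_constant i j (conj_index k) * of_real (deg (conj_index k))"
    using coefficient_times_deg[OF conj_index_less[OF assms(3)], of "b i * b j"]
    by (simp add: structure_constant_def conj_index_conj_index)
  then show ?thesis
    using structure_constant_triple[OF assms(1,2) conj_index_less[OF assms(3)]]
      deg_pos[OF conj_index_less[OF assms(3)]]
    by (simp add: conj_index_conj_index)
qed

lemma triple_cycle: "triple i j k = triple j k i"
  using coefficient_0_commute[of "b i" "b j * b k"] by (simp add: triple_def mult.assoc)

lemma triple_star:
  assumes "i < 6" "j < 6" "k < 6"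
  shows "triple i j k = triple (conj_index k) (conj_index j) (conj_index i)"
proof -
  have "star (b i * b j * b k) = b (conj_index k) * b (conj_index j) * b (conj_index i)"
    using assms by (simp add: star_mult star_b mult.assoc)
  then show ?thesis
    using coefficient_0_star[of "b i * b j * b k"] by (simp add: triple_def)
qed

lemma triple_nonneg:
  assumes "i < 6" "j < 6" "k < 6"
  shows "0 \<le> triple i j k"
proof -
  note k' = conj_index_less[OF assms(3)]
  have "0 \<le> triple i j k / deg (conj_index k)"
    using structure_constant_nonneg[OF assms(1,2) k'] structure_constant_triple[OF assms(1,2) k']
    by (simp add: conj_index_conj_index)
  then show ?thesis
    using deg_pos[OF k'] by (simp add: zero_le_divide_iff)
qed

text \<open>Multiplicativity of the degree map: the factor \<open>deg k\<close> cancels the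
  denominator of the structure constant, and \<open>conj_index\<close> only permutes the
  summands.\<close>

lemma triple_sum:
  assumes "i < 6" "j < 6"
  shows "(\<Sum>k<6. triple i j k) = deg i * deg j"
proof -
  have "deg i * deg j = (\<Sum>k<6. Re (structure_constant i j k) * deg k)"
    using degree_product[OF degree_map assms] by (simp add: deg_def)
  also have "\<dots> = (\<Sum>k<6. triple i j (conj_index k))"
    using deg_pos by (intro sum.cong) (auto simp: structure_constant_triple[OF assms] less_imp_neq[symmetric])
  also have "\<dots> = (\<Sum>k<6. triple i j k)"
    by (intro sum.reindex_bij_witness[of _ conj_index conj_index])
      (auto simp: conj_index_conj_index conj_index_less)
  finally show ?thesis
    by simp
qed

lemma triple_0:
  assumes "i < 6" "j < 6"
  shows "triple 0 i j = (if j = conj_index i then deg i else 0)"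
proof -
  have "of_real (triple 0 i j) = coefficient (b i) (conj_index j) * of_real (deg (conj_index j))"
    using coefficient_triple[of 0 i j] coefficient_times_deg[OF conj_index_less[OF assms(2)], of "b i"] assms
    by (simp add: b_0 conj_index_conj_index)
  also have "\<dots> = of_real (if j = conj_index i then deg i else 0)"
    using coefficient_basis[OF assms(1) conj_index_less[OF assms(2)]] conj_index_conj_index
    by (auto simp: deg_conj_index)
  finally show ?thesis
    by (simp only: of_real_eq_iff)
qed

text \<open>Both sides compute \<open>coefficient (b i * b j * b l * b m) 0\<close>, grouped in the two
  ways that respect its cyclic symmetry.\<close>

lemma triple_assoc:
  assumes "i < 6" "j < 6" "l < 6" "m < 6"
  shows "(\<Sum>k<6. triple i j (conj_index k) * triple k l m / deg k)
    = (\<Sum>k<6. triple m i (conj_index k) * triple k j l / deg k)"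
proof -
  have expand: "coefficient (b i * b j * (b l * b m)) 0
      = of_real (\<Sum>k<6. triple i j (conj_index k) * triple k l m / deg k)"
    if "i < 6" "j < 6" "l < 6" "m < 6" for i j l m
  proof -
    have "coefficient (b i * b j * (b l * b m)) 0
        = (\<Sum>k<6. structure_constant i j k * coefficient (b k * (b l * b m)) 0)"
      unfolding structure_constant_def
      by (rule functional_expansion[of "\<lambda>x. coefficient (x * (b l * b m)) 0"])
        (simp_all add: distrib_right coefficient_add coefficient_scale scale_mult_left)
    also have "\<dots> = (\<Sum>k<6. of_real (triple i j (conj_index k) * triple k l m / deg k))"
      using that by (intro sum.cong)
        (auto simp: structure_constant_triple coefficient_triple simp flip: mult.assoc)
    finally show ?thesis
      by simp
  qed
  have "coefficient (b i * b j * (b l * b m)) 0 = coefficient (b m * b i * (b j * b l)) 0"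
    using coefficient_0_commute[of "b i * b j * b l" "b m"] by (simp add: mult.assoc)
  then show ?thesis
    using expand[OF assms] expand[OF assms(4,1,2,3)] by (simp only: of_real_eq_iff)
qed

lemma coefficient_eqI:
  assumes "\<And>k. k < 6 \<Longrightarrow> coefficient x k = coefficient y k"
  shows "x = y"
  using basis_expansion[of x] basis_expansion[of y] assms by simp

text \<open>The sum \<open>S\<close> of the basis satisfies
  \<open>b i * S = \<delta> (b i) * S\<close>. Applying \<open>\<phi>\<close> at an \<open>i\<close>
  where it differs from \<open>\<delta>\<close> forces \<open>\<phi> S = 0\<close>.\<close>

lemma sum_phi: "(\<Sum>k<6. \<phi> (b k)) = 0"
proof -
  obtain i where i: "i < 6" "\<phi> (b i) \<noteq> \<delta> (b i)"
  proof (rule ccontr)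
    assume "\<not> thesis"
    then have "\<forall>i<6. \<phi> (b i) = \<delta> (b i)"
      using that by blast
    then have "\<phi> x = \<delta> x" for x
      using linear_character_expansion[OF phi(1), of x]
        linear_character_expansion[OF character_degree, of x] by simp
    then show False
      using phi(2) by auto
  qed
  \<comment> \<open>This is the coefficient of \<open>b k\<close> in \<open>b i * S\<close>; a
    cyclic shift turns it into an instance of \<open>triple_sum\<close>.\<close>
  have "(\<Sum>j<6. structure_constant i j k) = of_real (deg i)" if k: "k < 6" for k
  proof -
    have "(\<Sum>j<6. triple i j (conj_index k)) = deg k * deg i"
      using triple_sum[OF conj_index_less[OF k] i(1)]
      by (simp add: triple_cycle[of _ _ "conj_index k"] triple_cycle[of "conj_index k"] deg_conj_index)
    then have "(\<Sum>j<6. triple i j (conj_index k) / deg k) = deg i"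
      using deg_pos[OF k] by (simp add: field_simps flip: sum_divide_distrib)
    then show ?thesis
      using i(1) k by (simp add: structure_constant_triple del: of_real_divide flip: of_real_sum)
  qed
  then have "(\<Sum>k<6. (\<Sum>j<6. structure_constant i j k) * \<phi> (b k)) = \<delta> (b i) * (\<Sum>k<6. \<phi> (b k))"
    by (simp add: sum_distrib_left degree_eq_deg[OF i(1)])
  moreover have "\<phi> (b i) * (\<Sum>j<6. \<phi> (b j)) = (\<Sum>k<6. (\<Sum>j<6. structure_constant i j k) * \<phi> (b k))"
    unfolding sum_distrib_left sum_distrib_right
    by (subst sum.swap) (simp add: character_product[OF phi(1)])
  ultimately show ?thesis
    using i(2) by simp
qed

end


section \<open>The parity grading\<close>

context nonreal_bipartite_rank_6
begin

lemma phi_in_kernel: "i \<in> {0, 4, 5} \<Longrightarrow> \<phi> (b i) = \<delta> (b i)"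
proof -
  assume "i \<in> {0, 4, 5}"
  then have "b i \<in> kernel \<delta> \<phi>"
    using kernel_phi by auto
  then show ?thesis
    by (auto simp: kernel_def)
qed

lemma phi_not_in_kernel: "i \<in> {1, 2, 3} \<Longrightarrow> \<phi> (b i) \<noteq> \<delta> (b i)"
proof
  assume i: "i \<in> {1, 2, 3}" and "\<phi> (b i) = \<delta> (b i)"
  then have "b i \<in> {b 0, b 4, b 5}"
    unfolding kernel_phi[symmetric] kernel_def by auto
  then obtain j where j: "j \<in> {0, 4, 5}" "b i = b j"
    by blast
  then have "i = j"
    using inj_onD[OF inj_b, of i j] i by auto
  then show False
    using i j(1) by auto
qed

lemma triple_closed:
  assumes "i \<in> {0, 4, 5}" "j \<in> {0, 4, 5}" "k \<in> {1, 2, 3}"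
  shows "triple i j k = 0"
proof -
  have less: "i < 6" "j < 6" "k < 6"
    using assms by auto
  have "structure_constant i j k = 0"
    by (rule structure_constant_eq_0[OF degree_map phi(1) less])
      (use phi_in_kernel phi_not_in_kernel assms in auto)
  moreover have "conj_index k = k"
    using assms(3) by (auto simp: conj_index_def)
  ultimately show ?thesis
    using structure_constant_triple[OF less] deg_pos[OF less(3)] by simp
qed

text \<open>Cyclic shifts and \<open>star\<close> leave two unknowns, \<open>triple 4 4 4\<close>
  and \<open>triple 4 4 5\<close>. As the kernel is closed, \<open>triple_sum\<close> at
  \<open>(4, 4)\<close> and \<open>(4, 5)\<close> determines them.\<close>

lemma triple_kernel:
  "triple 4 4 0 = 0" "triple 4 5 0 = deg 4" "triple 5 4 0 = deg 4" "triple 5 5 0 = 0"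
  "triple 4 4 4 = (deg 4 * deg 4 + deg 4) / 2" "triple 5 5 5 = (deg 4 * deg 4 + deg 4) / 2"
  "triple 4 4 5 = (deg 4 * deg 4 - deg 4) / 2" "triple 4 5 4 = (deg 4 * deg 4 - deg 4) / 2"
  "triple 5 4 4 = (deg 4 * deg 4 - deg 4) / 2" "triple 4 5 5 = (deg 4 * deg 4 - deg 4) / 2"
  "triple 5 4 5 = (deg 4 * deg 4 - deg 4) / 2" "triple 5 5 4 = (deg 4 * deg 4 - deg 4) / 2"
proof -
  have unit: "triple i j 0 = (if j = conj_index i then deg i else 0)" if "i < 6" "j < 6" for i j
    using triple_0[OF that] triple_cycle[of 0 i j] by simp
  show u: "triple 4 4 0 = 0" "triple 4 5 0 = deg 4" "triple 5 4 0 = deg 4" "triple 5 5 0 = 0"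
    by (simp_all add: unit conj_index_def deg_5)
  have odd: "triple 4 j k = 0" if "j \<in> {4, 5}" "k \<in> {1, 2, 3}" for j k
    using that triple_closed by auto
  have sums: "triple 4 4 4 + triple 4 4 5 = deg 4 * deg 4"
    "deg 4 + triple 4 5 4 + triple 4 5 5 = deg 4 * deg 4"
    using triple_sum[of 4 4] triple_sum[of 4 5] odd[of 4] odd[of 5] u
    by (simp_all add: sum_lessThan_6 deg_5)
  have star: "triple 5 5 5 = triple 4 4 4" "triple 4 5 5 = triple 4 4 5"
    using triple_star[of 5 5 5] triple_star[of 4 5 5] by (simp_all add: conj_index_def)
  have cyc: "triple 4 5 4 = triple 4 4 5" "triple 5 4 4 = triple 4 4 5"
    "triple 5 4 5 = triple 4 5 5" "triple 5 5 4 = triple 4 5 5"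
    using triple_cycle by metis+
  have "triple 4 4 5 = (deg 4 * deg 4 - deg 4) / 2"
    using sums(2) star cyc by (simp add: field_simps)
  moreover from this have "triple 4 4 4 = (deg 4 * deg 4 + deg 4) / 2"
    using sums(1) by (simp add: field_simps)
  ultimately show "triple 4 4 4 = (deg 4 * deg 4 + deg 4) / 2" "triple 5 5 5 = (deg 4 * deg 4 + deg 4) / 2"
    "triple 4 4 5 = (deg 4 * deg 4 - deg 4) / 2" "triple 4 5 4 = (deg 4 * deg 4 - deg 4) / 2"
    "triple 5 4 4 = (deg 4 * deg 4 - deg 4) / 2" "triple 4 5 5 = (deg 4 * deg 4 - deg 4) / 2"
    "triple 5 4 5 = (deg 4 * deg 4 - deg 4) / 2" "triple 5 5 4 = (deg 4 * deg 4 - deg 4) / 2"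
    using star cyc by simp_all
qed

text \<open>Nonnegativity of \<open>triple 4 4 5\<close>, which is half of
  \<open>deg 4 * (deg 4 - 1)\<close>.\<close>

lemma deg_4_ge_1: "1 \<le> deg 4"
proof -
  have "deg 4 * 1 \<le> deg 4 * deg 4"
    using triple_nonneg[of 4 4 5] triple_kernel(7) by simp
  then show ?thesis
    using deg_pos[of 4] by (simp only: mult_le_cancel_left_pos)
qed

section \<open>The kernel sum and the values of the second linear character\<close>

abbreviation kernel_sum :: 'a where
  "kernel_sum \<equiv> b 0 + b 4 + b 5"

text \<open>The degree of \<open>kernel_sum\<close>, because \<open>deg 0 = 1\<close> and
  \<open>deg 5 = deg 4\<close>.\<close>

abbreviation kernel_order :: real where
  "kernel_order \<equiv> 1 + 2 * deg 4"

lemma kernel_sum_square: "kernel_sum * kernel_sum = of_real kernel_order *\<^sub>A kernel_sum"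
proof -
  have coef: "coefficient kernel_sum k = (if k \<in> {0, 4, 5} then 1 else 0)" if "k < 6" for k
    using that by (auto simp: coefficient_add coefficient_basis)
  \<comment> \<open>For \<open>k\<close> in the kernel the coefficient of \<open>b k\<close> is,
    after a cyclic shift, \<open>triple_sum\<close> at \<open>(conj_index k, i)\<close>, whose terms
    outside the kernel vanish. For other \<open>k\<close> every term vanishes.\<close>
  have absorb: "b i * kernel_sum = of_real (deg i) *\<^sub>A kernel_sum" if i: "i \<in> {0, 4, 5}" for i
  proof (rule coefficient_eqI)
    fix k :: nat assume k: "k < 6"
    have i6: "i < 6"
      using i by auto
    have "coefficient (b i * kernel_sum) k * of_real (deg k)
        = of_real (triple i 0 (conj_index k) + triple i 4 (conj_index k) + triple i 5 (conj_index k))"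
      using k i6 conj_index_less[OF k]
      by (simp add: coefficient_times_deg coefficient_triple coefficient_add distrib_left distrib_right)
    also have "triple i 0 (conj_index k) + triple i 4 (conj_index k) + triple i 5 (conj_index k)
        = (if k \<in> {0, 4, 5} then deg i else 0) * deg k"
    proof -
      consider "k \<in> {1, 2, 3}" | "k \<in> {0, 4, 5}"
        using k by force
      then show ?thesis
      proof cases
        case 1
        then have "conj_index k = k"
          by (auto simp: conj_index_def)
        moreover have "k \<notin> {0, 4, 5}"
          using 1 by auto
        ultimately show ?thesis
          using triple_closed[OF i _ 1] by simp
      next
        case 2
        then have c: "conj_index k \<in> {0, 4, 5}"
          by (auto simp: conj_index_def)
        have "deg k * deg i = (\<Sum>j<6. triple (conj_index k) i j)"
          using triple_sum[OF conj_index_less[OF k] i6] by (simp add: deg_conj_index)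
        also have "\<dots> = triple (conj_index k) i 0 + triple (conj_index k) i 4 + triple (conj_index k) i 5"
          using triple_closed[OF c i] by (simp add: sum_lessThan_6)
        finally show ?thesis
          using 2 triple_cycle[of "conj_index k" i 0] triple_cycle[of "conj_index k" i 4]
            triple_cycle[of "conj_index k" i 5] by (simp add: mult.commute)
      qed
    qed
    finally show "coefficient (b i * kernel_sum) k = coefficient (of_real (deg i) *\<^sub>A kernel_sum) k"
      using deg_pos[OF k] by (simp add: coefficient_scale coef[OF k])
  qed
  have "kernel_sum * kernel_sum = of_real (deg 0) *\<^sub>A kernel_sum + of_real (deg 4) *\<^sub>A kernel_sum
      + of_real (deg 5) *\<^sub>A kernel_sum"
    using absorb[of 0] absorb[of 4] absorb[of 5] by (simp add: distrib_right[of _ _ kernel_sum])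
  moreover have "complex_of_real kernel_order = of_real (deg 0) + of_real (deg 4) + of_real (deg 5)"
    by (simp add: deg_0 deg_5)
  ultimately show ?thesis
    by (simp only: scale_left_distrib)
qed

text \<open>The trace of \<open>\<rho> kernel_sum\<close> is \<open>0\<close>, \<open>m\<close> or \<open>2 m\<close> for \<open>m = kernel_order\<close>.
  Comparing \<open>standard_trace\<close> at \<open>1\<close> and at \<open>kernel_sum\<close> leaves only \<open>0\<close>, because \<open>m \<ge> 3\<close>.\<close>

lemma kernel_sum_representation:
  assumes \<rho>: "matrix_representation (\<rho> :: 'a \<Rightarrow> complex^2^2)" and \<xi>: "\<xi> = (\<lambda>x. trace (\<rho> x))"
  shows "\<rho> kernel_sum = 0" and "(\<Sum>i<6. deg i) = 2 * kernel_order"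
proof -
  define m n where "m = kernel_order" and "n = (\<Sum>i<6. deg i)"
  have m: "3 \<le> m"
    using deg_4_ge_1 by (simp add: m_def)
  have square: "\<rho> kernel_sum ** \<rho> kernel_sum = mat (of_real m) ** \<rho> kernel_sum"
    using \<rho> kernel_sum_square unfolding m_def by (metis matrix_representation_def)
  have std: "standard_trace \<delta> x = of_real n * coefficient x 0" for x
    by (simp add: standard_trace_def degree_eq_deg n_def)
  have "\<xi> 1 = 2"
    using \<rho> by (simp add: \<xi> matrix_representation_def trace_def sum_2 mat_def)
  moreover have "coefficient 1 0 = 1"
    using coefficient_basis[of 0 0] by (simp add: b_0)
  ultimately have "complex_of_real n = of_real (2 + 2 * m\<^sub>\<xi>)"
    using std[of 1] trace_decomposition[of 1] character_degree phi(1) multiplicity_phi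
    by (simp add: linear_character_def mult.commute)
  then have n1: "n = 2 + 2 * m\<^sub>\<xi>"
    by (simp only: of_real_eq_iff)
  have "\<delta> kernel_sum = of_real m" "\<phi> kernel_sum = of_real m"
    using character_degree phi(1) phi_in_kernel[of 0] phi_in_kernel[of 4] phi_in_kernel[of 5]
    by (simp_all add: linear_character_def degree_eq_deg deg_0 deg_5 m_def)
  moreover have "coefficient kernel_sum 0 = 1"
    by (simp add: coefficient_add coefficient_basis)
  ultimately have n2: "complex_of_real n = of_real m + of_real m + of_real m\<^sub>\<xi> * trace (\<rho> kernel_sum)"
    using std[of kernel_sum] trace_decomposition[of kernel_sum] multiplicity_phi by (simp add: \<xi>)
  have trace: "trace (\<rho> kernel_sum) = 0"
  proof (rule ccontr)
    assume "trace (\<rho> kernel_sum) \<noteq> 0"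
    \<comment> \<open>Here \<open>c\<close> is 1 or 2, so
      \<open>n = 2 * m + m\<^sub>\<xi> * c * m\<close> is at least
      \<open>6 + 3 * m\<^sub>\<xi>\<close>, exceeding the value \<open>2 + 2 * m\<^sub>\<xi>\<close>
      found at 1.\<close>
    then obtain c :: real where c: "1 \<le> c" "trace (\<rho> kernel_sum) = of_real (c * m)"
      using square_matrix_2_cases(1)[OF square] that[of 1] that[of 2] by auto
    then have "complex_of_real n = of_real (m + m + m\<^sub>\<xi> * (c * m))"
      using n2 by simp
    then have "n = m + m + m\<^sub>\<xi> * (c * m)"
      by (simp only: of_real_eq_iff)
    moreover have "m\<^sub>\<xi> * 3 \<le> m\<^sub>\<xi> * (c * m)"
      using multiplicities_pos(2) c(1) m mult_mono[of 1 c 3 m] by simp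
    ultimately show False
      using n1 m multiplicities_pos(2) by linarith
  qed
  then show "\<rho> kernel_sum = 0"
    using square_matrix_2_cases(2)[OF square] m by simp
  have "complex_of_real n = of_real (2 * m)"
    using n2 trace by simp
  then show "(\<Sum>i<6. deg i) = 2 * kernel_order"
    by (simp only: of_real_eq_iff m_def n_def)
qed

lemma representation_exists:
  obtains \<rho> :: "'a \<Rightarrow> complex^2^2"
  where "matrix_representation \<rho>" "\<xi> = (\<lambda>x. trace (\<rho> x))"
  using chi by (auto simp: irreducible_character_degree_2_def irreducible_representation_def)

lemma sum_deg: "(\<Sum>i<6. deg i) = 2 * kernel_order"
  using kernel_sum_representation(2) representation_exists by blast

lemma deg_sum_odd: "deg 1 + deg 2 + deg 3 = kernel_order"
  using sum_deg by (simp add: sum_lessThan_6 deg_0 deg_5)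

text \<open>By \<open>sum_phi\<close> and \<open>deg_sum_odd\<close> the three real parts sum to
  minus the sum of the degrees, while each is at least minus its degree. All are therefore extremal,
  and \<open>character_bound\<close> kills the imaginary parts.\<close>

lemma phi_odd:
  assumes "i \<in> {1, 2, 3}"
  shows "\<phi> (b i) = - \<delta> (b i)"
proof -
  have bound: "cmod (\<phi> (b j)) \<le> deg j" if "j < 6" for j
    using character_bound[OF degree_map phi(1) that] by (simp add: deg_def)
  have lower: "- deg j \<le> Re (\<phi> (b j))" if "j < 6" for j
    using bound[OF that] abs_Re_le_cmod[of "\<phi> (b j)"] by linarith
  have "\<phi> (b 0) = 1" "\<phi> (b 4) = of_real (deg 4)" "\<phi> (b 5) = of_real (deg 4)"
    using phi_in_kernel[of 0] phi_in_kernel[of 4] phi_in_kernel[of 5]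
    by (simp_all add: degree_eq_deg deg_0 deg_5)
  then have "Re (\<phi> (b 1)) + Re (\<phi> (b 2)) + Re (\<phi> (b 3)) = - kernel_order"
    using arg_cong[OF sum_phi, of Re] by (simp add: sum_lessThan_6)
  then have "Re (\<phi> (b 1)) = - deg 1" "Re (\<phi> (b 2)) = - deg 2" "Re (\<phi> (b 3)) = - deg 3"
    using lower[of 1] lower[of 2] lower[of 3] deg_sum_odd by linarith+
  then have re: "Re (\<phi> (b i)) = - deg i"
    using assms by auto
  have i: "i < 6"
    using assms by auto
  have "(deg i)\<^sup>2 + (Im (\<phi> (b i)))\<^sup>2 \<le> (deg i)\<^sup>2"
    using power_mono[OF bound[OF i] norm_ge_zero, of 2] by (simp add: cmod_power2 re)
  then show ?thesis
    by (simp add: complex_eq_iff re degree_eq_deg[OF i])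
qed

text \<open>The two signs from \<open>phi_odd\<close> cancel, so \<open>\<phi>\<close> and
  \<open>\<delta>\<close> agree on \<open>b i * b j\<close>, which then has constituents in the
  kernel only.\<close>

lemma triple_odd:
  assumes "i \<in> {1, 2, 3}" "j \<in> {1, 2, 3}" "k \<in> {1, 2, 3}"
  shows "triple i j k = 0"
proof -
  have less: "i < 6" "j < 6" "k < 6"
    using assms by auto
  have "structure_constant i j k = 0"
    by (rule structure_constant_eq_0[OF degree_map phi(1) less])
      (simp_all add: phi_odd[OF assms(1)] phi_odd[OF assms(2)] phi_not_in_kernel[OF assms(3)])
  moreover have "conj_index k = k"
    using assms(3) by (auto simp: conj_index_def)
  ultimately show ?thesis
    using structure_constant_triple[OF less] deg_pos[OF less(3)] by simp
qed

text \<open>On \<open>kernel_sum * b i * b j\<close> the character \<open>\<xi>\<close> vanishes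
  while \<open>\<delta>\<close> and \<open>\<phi>\<close> agree. The trace formula thus gives the
  sum of \<open>triple 0 i j\<close>, \<open>triple 4 i j\<close> and \<open>triple 5 i j\<close>,
  and \<open>triple 5 i j = triple 4 j i\<close>.\<close>

lemma triple_4_commute:
  assumes "i \<in> {1, 2, 3}" "j \<in> {1, 2, 3}"
  shows "triple 4 i j + triple 4 j i = deg i * deg j - (if i = j then deg i else 0)"
proof -
  obtain \<rho> :: "'a \<Rightarrow> complex^2^2"
    where \<rho>: "matrix_representation \<rho>" "\<xi> = (\<lambda>x. trace (\<rho> x))"
    by (rule representation_exists)
  define x where "x = kernel_sum * b i * b j"
  have less: "i < 6" "j < 6"
    using assms by auto
  have conj: "conj_index i = i" "conj_index j = j"
    using assms by (auto simp: conj_index_def)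
  have "\<rho> x = 0"
    using \<rho>(1) kernel_sum_representation(1)[OF \<rho>] by (simp add: x_def matrix_representation_def)
  then have "\<xi> x = 0"
    by (simp add: \<rho>(2) trace_def)
  moreover have "\<delta> x = of_real (kernel_order * (deg i * deg j))"
    using character_degree less by (simp add: linear_character_def x_def degree_eq_deg deg_0 deg_5)
  moreover have "\<phi> x = of_real (kernel_order * (deg i * deg j))"
    using phi(1) less phi_in_kernel[of 0] phi_in_kernel[of 4] phi_in_kernel[of 5]
      phi_odd[OF assms(1)] phi_odd[OF assms(2)]
    by (simp add: linear_character_def x_def degree_eq_deg deg_0 deg_5)
  ultimately have "standard_trace \<delta> x = of_real (2 * kernel_order * (deg i * deg j))"
    using trace_decomposition[of x] multiplicity_phi by simp
  moreover have "standard_trace \<delta> x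
      = of_real (2 * kernel_order * (triple 0 i j + triple 4 i j + triple 5 i j))"
  proof -
    have "(\<Sum>i<6. \<delta> (b i)) = of_real (2 * kernel_order)"
      unfolding sum_deg[symmetric] by (simp add: degree_eq_deg)
    moreover have "coefficient x 0 = of_real (triple 0 i j + triple 4 i j + triple 5 i j)"
      using less by (simp add: x_def distrib_right coefficient_add coefficient_triple)
    ultimately show ?thesis
      by (simp add: standard_trace_def)
  qed
  ultimately have "2 * kernel_order * (triple 0 i j + triple 4 i j + triple 5 i j)
      = 2 * kernel_order * (deg i * deg j)"
    by (simp only: of_real_eq_iff)
  moreover have order_neq_0: "2 * kernel_order \<noteq> 0"
    using deg_pos[of 4] by simp
  ultimately have "triple 0 i j + triple 4 i j + triple 5 i j = deg i * deg j"
    by (simp only: mult_left_cancel[OF order_neq_0])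
  moreover have "triple 5 i j = triple 4 j i"
    using triple_star[of 5 i j] triple_cycle[of 4 j i] less conj by (simp add: conj_index_def[of 5])
  ultimately show ?thesis
    using triple_0[OF less] by (simp add: conj split: if_splits)
qed

section \<open>All triples from the degrees and one parameter\<close>

lemma conj_index_odd: "i \<in> {1, 2, 3} \<Longrightarrow> conj_index i = i"
  by (auto simp: conj_index_def)

lemma triple_unit_right:
  assumes "i < 6" "j < 6"
  shows "triple i 0 j = (if j = conj_index i then deg i else 0)"
    and "triple i j 0 = (if j = conj_index i then deg i else 0)"
proof -
  have "triple i 0 j = triple 0 j i" "triple i j 0 = triple 0 i j"
    using triple_cycle by metis+
  moreover have "i = conj_index j \<longleftrightarrow> j = conj_index i"
    using conj_index_conj_index by metis
  ultimately show "triple i 0 j = (if j = conj_index i then deg i else 0)"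
    "triple i j 0 = (if j = conj_index i then deg i else 0)"
    using triple_0[OF assms] triple_0[OF assms(2,1)] by (auto simp: deg_conj_index)
qed

text \<open>Normal form \<open>triple 4 _ _\<close>: a cyclic shift moves the kernel index to the
  front, and \<open>star\<close> trades 5 for 4 while exchanging the other two.\<close>

lemma triple_mixed:
  assumes "i \<in> {1, 2, 3}" "j \<in> {1, 2, 3}"
  shows "triple i 4 j = triple 4 j i" "triple i j 4 = triple 4 i j"
    "triple 5 i j = triple 4 j i" "triple i 5 j = triple 4 i j" "triple i j 5 = triple 4 j i"
proof -
  have star: "triple 5 i j = triple 4 j i" if "i \<in> {1, 2, 3}" "j \<in> {1, 2, 3}" for i j
  proof -
    have "triple 5 i j = triple j i 4"
      using triple_star[of 5 i j] that by (auto simp: conj_index_def)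
    then show ?thesis
      using triple_cycle[of 4 j i] by simp
  qed
  show "triple i 4 j = triple 4 j i" "triple i j 4 = triple 4 i j" "triple 5 i j = triple 4 j i"
    using triple_cycle[of i 4 j] triple_cycle[of 4 i j] star assms by auto
  show "triple i 5 j = triple 4 i j" "triple i j 5 = triple 4 j i"
    using triple_cycle[of i 5 j] triple_cycle[of 5 i j] star[OF assms] star[OF assms(2,1)] by auto
qed

text \<open>\<open>triple_4_commute\<close> fixes the diagonal and the symmetric part. The row sums
  spread one antisymmetric parameter \<open>u\<close> cyclically over the pairs, and associativity
  fixes its square.\<close>

lemma triple_4_parametrization:
  obtains u where "u\<^sup>2 = deg 1 * deg 2 * deg 3"
    "triple 4 1 1 = deg 1 * (deg 1 - 1) / 2" "triple 4 2 2 = deg 2 * (deg 2 - 1) / 2"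
    "triple 4 3 3 = deg 3 * (deg 3 - 1) / 2"
    "triple 4 1 2 = (deg 1 * deg 2 + u) / 2" "triple 4 2 1 = (deg 1 * deg 2 - u) / 2"
    "triple 4 2 3 = (deg 2 * deg 3 + u) / 2" "triple 4 3 2 = (deg 2 * deg 3 - u) / 2"
    "triple 4 3 1 = (deg 1 * deg 3 + u) / 2" "triple 4 1 3 = (deg 1 * deg 3 - u) / 2"
proof -
  \<comment> \<open>By \<open>triple_4_commute\<close> this equals
    \<open>triple 4 1 2 - triple 4 2 1\<close>.\<close>
  define u where "u = 2 * triple 4 1 2 - deg 1 * deg 2"
  have diag: "triple 4 i i = deg i * (deg i - 1) / 2" if "i \<in> {1, 2, 3}" for i
    using triple_4_commute[OF that that] by (simp add: field_simps)
  have row: "triple 4 i 1 + triple 4 i 2 + triple 4 i 3 = deg 4 * deg i" if i: "i \<in> {1, 2, 3}" for i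
  proof -
    have "triple 4 i k = 0" if "k \<in> {0, 4, 5}" for k
      using triple_closed[of k 4 i] triple_cycle[of 4 i k] triple_cycle[of i k 4] i that by auto
    then show ?thesis
      using triple_sum[of 4 i] i by (auto simp: sum_lessThan_6)
  qed
  have d4: "deg 4 = (deg 1 + deg 2 + deg 3 - 1) / 2"
    using deg_sum_odd by simp
  have t12: "triple 4 1 2 = (deg 1 * deg 2 + u) / 2" "triple 4 2 1 = (deg 1 * deg 2 - u) / 2"
    using triple_4_commute[of 1 2] by (simp_all add: u_def)
  have t11: "triple 4 1 1 = deg 1 * (deg 1 - 1) / 2"
    by (rule diag) simp
  have t13: "triple 4 1 3 = (deg 1 * deg 3 - u) / 2"
    using row[of 1] diag[of 1] t12 unfolding d4 by (simp add: field_simps)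
  have t23: "triple 4 2 3 = (deg 2 * deg 3 + u) / 2"
    using row[of 2] diag[of 2] t12 unfolding d4 by (simp add: field_simps)
  have t31: "triple 4 3 1 = (deg 1 * deg 3 + u) / 2" and t32: "triple 4 3 2 = (deg 2 * deg 3 - u) / 2"
    using triple_4_commute[of 1 3] triple_4_commute[of 2 3] t13 t23 by (simp_all add: field_simps)
  have pos: "0 < deg 1" "0 < deg 2" "0 < deg 3" "0 < deg 4"
    using deg_pos by simp_all
  \<comment> \<open>Associativity for \<open>b 4 * b 4 * b 1 * b 1\<close>: one grouping passes
    through the kernel, the other through the odd elements.\<close>
  have "triple 4 4 5 * triple 4 1 1 / deg 4 + triple 4 4 4 * triple 5 1 1 / deg 4
      = triple 1 4 1 * triple 1 4 1 / deg 1 + triple 1 4 2 * triple 2 4 1 / deg 2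
        + triple 1 4 3 * triple 3 4 1 / deg 3"
    using triple_assoc[of 4 4 1 1] triple_closed[of 4 4] triple_odd[of _ 1 1] triple_kernel(1)
      triple_closed[of 0 4 1] triple_closed[of 4 4 1] triple_closed[of 5 4 1]
    by (simp add: sum_lessThan_6 conj_index_def deg_5)
  \<comment> \<open>\<open>triple 5 1 1 = triple 4 1 1\<close>, and the two kernel triples sum to
    \<open>deg 4 * deg 4\<close>.\<close>
  also have "triple 4 4 5 * triple 4 1 1 / deg 4 + triple 4 4 4 * triple 5 1 1 / deg 4
      = deg 4 * triple 4 1 1"
    using pos triple_mixed(3)[of 1 1] by (simp add: triple_kernel field_simps)
  finally have "deg 4 * triple 4 1 1 = triple 4 1 1 * triple 4 1 1 / deg 1
      + triple 4 1 2 * triple 4 2 1 / deg 2 + triple 4 1 3 * triple 4 3 1 / deg 3"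
    using triple_mixed(1)[of 1 1] triple_mixed(1)[of 1 2] triple_mixed(1)[of 2 1]
      triple_mixed(1)[of 1 3] triple_mixed(1)[of 3 1] by (simp add: mult.commute)
  \<comment> \<open>The products of opposite entries are differences of squares, so the equation is
    linear in the square of \<open>u\<close>.\<close>
  then have "deg 1 * ((deg 2 + deg 3) * (u\<^sup>2 - deg 1 * deg 2 * deg 3)) = 0"
    unfolding t11 t12 t13 t31 d4 using pos by (simp add: field_simps power2_eq_square)
  then have "u\<^sup>2 = deg 1 * deg 2 * deg 3"
    using pos by simp
  then show thesis
    using that diag[of 1] diag[of 2] diag[of 3] t12 t13 t23 t31 t32 by simp
qed

section \<open>Integrality expressed by triples\<close>

lemma integral_structure_triple:
  "integral_structure \<longleftrightarrow> (\<forall>i<6. \<forall>j<6. \<forall>k<6. triple i j (conj_index k) / deg k \<in> \<int>)"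
  unfolding integral_structure_def by (simp add: structure_constant_triple del: of_real_divide)

text \<open>Up to cyclic shifts and \<open>star\<close> the nontrivial triples are
  \<open>triple 4 4 4\<close>, \<open>triple 4 4 5\<close> and \<open>triple 4 i j\<close> with
  \<open>i\<close>, \<open>j\<close> odd elements. The last kind occurs as numerator over the degree
  of each of its three indices.\<close>

lemma integral_structure_iff:
  "integral_structure \<longleftrightarrow>
    deg 1 \<in> \<int> \<and> deg 2 \<in> \<int> \<and> deg 3 \<in> \<int> \<and> deg 4 \<in> \<int> \<and>
    triple 4 4 4 / deg 4 \<in> \<int> \<and> triple 4 4 5 / deg 4 \<in> \<int> \<and>
    (\<forall>i\<in>{1, 2, 3}. \<forall>j\<in>{1, 2, 3}. triple 4 i j / deg i \<in> \<int> \<and> triple 4 i j / deg j \<in> \<int> \<and>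
      triple 4 i j / deg 4 \<in> \<int>)"
  (is "_ \<longleftrightarrow> ?R")
proof
  assume "integral_structure"
  then have int: "triple i j (conj_index k) / deg k \<in> \<int>" if "i < 6" "j < 6" "k < 6" for i j k
    using that integral_structure_triple by blast
  \<comment> \<open>A degree is itself a structure constant, the coefficient of \<open>b 0\<close>
    in \<open>b i * star (b i)\<close>.\<close>
  have degs: "deg i \<in> \<int>" if "i < 6" for i
    using int[OF that conj_index_less[OF that], of 0] that conj_index_less[OF that]
      triple_unit_right(2)[OF that conj_index_less[OF that]]
    by (simp add: conj_index_def deg_0)
  have odd: "triple 4 i j / deg i \<in> \<int> \<and> triple 4 i j / deg j \<in> \<int> \<and> triple 4 i j / deg 4 \<in> \<int>"
    if ij: "i \<in> {1, 2, 3}" "j \<in> {1, 2, 3}" for i j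
  proof -
    have less: "i < 6" "j < 6"
      using ij by auto
    have "triple 4 i (conj_index j) / deg j \<in> \<int>" "triple 5 j (conj_index i) / deg i \<in> \<int>"
      "triple i j (conj_index 5) / deg 5 \<in> \<int>"
      using int less by simp_all
    then show ?thesis
      using ij by (simp only: conj_index_odd triple_mixed deg_5) (simp add: conj_index_def triple_mixed)
  qed
  show ?R
    using degs[of 1] degs[of 2] degs[of 3] degs[of 4] odd int[of 4 4 4] int[of 4 4 5]
    by (simp add: conj_index_def deg_5)
next
  assume R: ?R
  have deg_int: "deg i \<in> \<int>" if "i < 6" for i
  proof -
    consider "i = 0" | "i = 1" | "i = 2" | "i = 3" | "i = 4" | "i = 5"
      using \<open>i < 6\<close> by linarith
    then show ?thesis
      using R by cases (simp_all add: deg_0 deg_5)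
  qed
  show integral_structure
    unfolding integral_structure_triple
  proof (intro allI impI)
    fix i j k :: nat assume less: "i < 6" "j < 6" "k < 6"
    note less' = conj_index_less[OF less(3)]
    have range: "x \<in> {0, 4, 5} \<or> x \<in> {1, 2, 3}" if "x < 6" for x :: nat
      using that by force
    consider "i = 0" | "j = 0" | "k = 0" | "i \<noteq> 0" "j \<noteq> 0" "k \<noteq> 0"
      by blast
    then show "triple i j (conj_index k) / deg k \<in> \<int>"
    proof cases
      case 1
      then show ?thesis
        using triple_0[OF less(2) less'] conj_index_conj_index deg_pos[OF less(3)]
        by (metis Ints_0 Ints_1 div_0 divide_self less_irrefl)
    next
      case 2
      then show ?thesis
        using triple_unit_right(1)[OF less(1) less'] conj_index_conj_index deg_pos[OF less(3)]
        by (metis Ints_0 Ints_1 div_0 divide_self less_irrefl)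
    next
      case 3
      then show ?thesis
        using triple_unit_right(2)[OF less(1,2)] deg_int[OF less(1)]
        by (simp add: conj_index_def deg_0)
    next
      case 4
      define l where "l = conj_index k"
      have l: "l \<noteq> 0" "l < 6" "deg k = deg l"
        using 4 less' by (auto simp: l_def conj_index_def deg_5)
      \<comment> \<open>By the parity grading a nonzero triple has no or exactly two indices in
        \<open>{1, 2, 3}\<close>, which leaves four patterns.\<close>
      have "(i \<in> {4, 5} \<or> i \<in> {1, 2, 3}) \<and> (j \<in> {4, 5} \<or> j \<in> {1, 2, 3}) \<and> (l \<in> {4, 5} \<or> l \<in> {1, 2, 3})"
        using range[OF less(1)] range[OF less(2)] range[OF l(2)] 4 l(1) by auto
      then consider "i \<in> {4, 5}" "j \<in> {4, 5}" "l \<in> {4, 5}" | "i \<in> {4, 5}" "j \<in> {1, 2, 3}" "l \<in> {1, 2, 3}"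
        | "i \<in> {1, 2, 3}" "j \<in> {4, 5}" "l \<in> {1, 2, 3}" | "i \<in> {1, 2, 3}" "j \<in> {1, 2, 3}" "l \<in> {4, 5}"
        | "triple i j l = 0"
        using triple_closed[of i j l] triple_closed[of j l i] triple_closed[of l i j]
          triple_odd[of i j l] triple_cycle[of i j l] triple_cycle[of l i j] by auto
      then have "triple i j l / deg l \<in> \<int>"
      proof cases
        case 1
        then show ?thesis
          using R by (auto simp: triple_kernel deg_5)
      next
        case 2
        then show ?thesis
          using R triple_mixed[OF 2(2,3)] by auto
      next
        case 3
        then show ?thesis
          using R triple_mixed[OF 3(1,3)] by auto
      next
        case 4
        then show ?thesis
          using R triple_mixed[OF 4(1,2)] by (auto simp: deg_5)
      qed simp
      then show ?thesis
        by (simp add: l_def[symmetric] l(3))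
    qed
  qed
qed

end


section \<open>Integrality\<close>

text \<open>Pure arithmetic with \<open>\<alpha> = gcd p q\<close> and
  \<open>\<gamma> = w\<close>.\<close>

lemma odd_square_products:
  fixes p q w d :: int
  assumes pos: "0 < p" "0 < q" "0 < w" and odd: "odd (p * w)" "odd (q * w)" "odd (p * q)"
    and sum: "p * w + q * w + p * q = 1 + 2 * d"
    and dvd: "d dvd p * q * w" "d dvd p * w * (p * w - 1)" "d dvd q * w * (q * w - 1)"
      "d dvd p * q * (p * q - 1)"
  shows "\<exists>\<alpha> \<gamma> k\<^sub>1 k\<^sub>2. 0 < \<alpha> \<and> odd \<alpha> \<and> 0 < \<gamma> \<and> odd \<gamma> \<and> 0 < k\<^sub>1 \<and> odd k\<^sub>1 \<and> 0 < k\<^sub>2 \<and> odd k\<^sub>2 \<and>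
    p * w = \<alpha> * \<gamma> * k\<^sub>1 \<and> q * w = \<alpha> * \<gamma> * k\<^sub>2 \<and> p * q = \<alpha>\<^sup>2 * k\<^sub>1 * k\<^sub>2 \<and>
    gcd k\<^sub>1 k\<^sub>2 = 1 \<and> \<alpha>\<^sup>2 < 2 * \<gamma> \<and>
    d dvd \<gamma> * k\<^sub>1 * k\<^sub>2 \<and> d dvd \<gamma> * k\<^sub>1 * (\<alpha> * \<gamma> * k\<^sub>1 - 1) \<and>
    d dvd \<gamma> * k\<^sub>2 * (\<alpha> * \<gamma> * k\<^sub>2 - 1) \<and> d dvd k\<^sub>1 * k\<^sub>2 * (\<alpha>\<^sup>2 * k\<^sub>1 * k\<^sub>2 - 1)"
proof -
  define \<alpha> where "\<alpha> = gcd p q"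
  obtain k\<^sub>1 k\<^sub>2 where k: "p = \<alpha> * k\<^sub>1" "q = \<alpha> * k\<^sub>2"
    unfolding \<alpha>_def by (meson dvdE gcd_dvd1 gcd_dvd2)
  have \<alpha>: "0 < \<alpha>"
    using pos by (simp add: \<alpha>_def)
  have "\<alpha> * gcd k\<^sub>1 k\<^sub>2 = \<alpha> * 1"
    using \<alpha> k by (metis \<alpha>_def abs_of_pos gcd_mult_distrib_int mult.right_neutral)
  then have gcd: "gcd k\<^sub>1 k\<^sub>2 = 1"
    using \<alpha> by (simp only: mult_left_cancel)
  have kpos: "0 < k\<^sub>1" "0 < k\<^sub>2"
    using pos \<alpha> k by (simp_all add: zero_less_mult_iff)
  have odds: "odd \<alpha>" "odd w" "odd k\<^sub>1" "odd k\<^sub>2"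
    using odd k by auto
  \<comment> \<open>A Bezout identity: a common divisor of \<open>d\<close> and
    \<open>\<alpha>\<close> divides 1.\<close>
  have "\<alpha> * (k\<^sub>1 * w + k\<^sub>2 * w + \<alpha> * k\<^sub>1 * k\<^sub>2) - 2 * d = 1"
    using sum by (simp add: k algebra_simps)
  then have "coprime d \<alpha>"
    by (intro coprimeI) (metis dvd_diff dvd_mult dvd_mult2)
  then have coprime: "coprime d \<alpha>" "coprime d (\<alpha>\<^sup>2)"
    by simp_all
  have "d dvd \<alpha>\<^sup>2 * (w * k\<^sub>1 * k\<^sub>2)" "d dvd \<alpha> * (w * k\<^sub>1 * (\<alpha> * w * k\<^sub>1 - 1))"
    "d dvd \<alpha> * (w * k\<^sub>2 * (\<alpha> * w * k\<^sub>2 - 1))" "d dvd \<alpha>\<^sup>2 * (k\<^sub>1 * k\<^sub>2 * (\<alpha>\<^sup>2 * k\<^sub>1 * k\<^sub>2 - 1))"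
    using dvd by (simp_all add: k algebra_simps power2_eq_square)
  then have dvds: "d dvd w * k\<^sub>1 * k\<^sub>2" "d dvd w * k\<^sub>1 * (\<alpha> * w * k\<^sub>1 - 1)"
    "d dvd w * k\<^sub>2 * (\<alpha> * w * k\<^sub>2 - 1)" "d dvd k\<^sub>1 * k\<^sub>2 * (\<alpha>\<^sup>2 * k\<^sub>1 * k\<^sub>2 - 1)"
    using coprime by (simp_all only: coprime_dvd_mult_right_iff)
  \<comment> \<open>With \<open>sum\<close> this yields
    \<open>p * q < 2 * d \<le> 2 * w * k\<^sub>1 * k\<^sub>2\<close>; cancelling
    \<open>k\<^sub>1 * k\<^sub>2\<close> gives the bound on the square of
    \<open>\<alpha>\<close>.\<close>
  have "d \<le> w * k\<^sub>1 * k\<^sub>2"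
    using dvds(1) pos kpos by (intro zdvd_imp_le) simp_all
  moreover have "0 < p * w" "0 < q * w"
    using pos by simp_all
  moreover have "p * q = \<alpha>\<^sup>2 * (k\<^sub>1 * k\<^sub>2)"
    by (simp add: k power2_eq_square)
  ultimately have "\<alpha>\<^sup>2 * (k\<^sub>1 * k\<^sub>2) < (2 * w) * (k\<^sub>1 * k\<^sub>2)"
    using sum by (simp add: algebra_simps)
  then have "\<alpha>\<^sup>2 < 2 * w"
    using kpos by (simp add: mult_less_cancel_right)
  then show ?thesis
    using \<alpha> odds pos(3) kpos gcd dvds
    by (intro exI[of _ \<alpha>] exI[of _ w] exI[of _ k\<^sub>1] exI[of _ k\<^sub>2]) (simp add: k power2_eq_square)
qed

lemma Ints_divide_iff:
  fixes a c :: int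
  assumes "c \<noteq> 0"
  shows "real_of_int a / real_of_int c \<in> \<int> \<longleftrightarrow> c dvd a"
proof
  assume "real_of_int a / real_of_int c \<in> \<int>"
  then obtain k where "real_of_int a / real_of_int c = of_int k"
    by (auto elim: Ints_cases)
  then have "real_of_int a = of_int (k * c)"
    using assms by (simp add: field_simps)
  then show "c dvd a"
    by (simp only: of_int_eq_iff) simp
next
  assume "c dvd a"
  then show "real_of_int a / real_of_int c \<in> \<int>"
    using assms by (auto simp: dvd_def)
qed

section \<open>Translation between integrality and the arithmetic parameters\<close>

context nonreal_bipartite_rank_6
begin

lemma integral_structure_imp_parameters:
  assumes "integral_structure"
  obtains p q w d :: int
  where "0 < p" "0 < q" "0 < w" "odd (p * w)" "odd (q * w)" "odd (p * q)"
    "p * w + q * w + p * q = 1 + 2 * d"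
    "d dvd p * q * w" "d dvd p * w * (p * w - 1)" "d dvd q * w * (q * w - 1)"
    "d dvd p * q * (p * q - 1)"
    "deg 1 = of_int (p * w)" "deg 2 = of_int (q * w)" "deg 3 = of_int (p * q)" "deg 4 = of_int d"
proof -
  obtain u where u: "u\<^sup>2 = deg 1 * deg 2 * deg 3"
    and t: "triple 4 1 1 = deg 1 * (deg 1 - 1) / 2" "triple 4 2 2 = deg 2 * (deg 2 - 1) / 2"
    "triple 4 3 3 = deg 3 * (deg 3 - 1) / 2"
    "triple 4 1 2 = (deg 1 * deg 2 + u) / 2" "triple 4 2 1 = (deg 1 * deg 2 - u) / 2"
    "triple 4 2 3 = (deg 2 * deg 3 + u) / 2" "triple 4 3 2 = (deg 2 * deg 3 - u) / 2"
    "triple 4 3 1 = (deg 1 * deg 3 + u) / 2" "triple 4 1 3 = (deg 1 * deg 3 - u) / 2"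
    by (rule triple_4_parametrization)
  have pos: "0 < deg 1" "0 < deg 2" "0 < deg 3" "0 < deg 4"
    using deg_pos by simp_all
  have ints: "triple 4 i j / deg i \<in> \<int>" "triple 4 i j / deg j \<in> \<int>" "triple 4 i j / deg 4 \<in> \<int>"
    if "i \<in> {1, 2, 3}" "j \<in> {1, 2, 3}" for i j
    using assms that unfolding integral_structure_iff by blast+
  \<comment> \<open>Opposite entries differ by exactly \<open>u\<close>, so \<open>u\<close>
    inherits divisibility by every degree.\<close>
  have "u / deg 1 = triple 4 1 2 / deg 1 - triple 4 2 1 / deg 1"
    "u / deg 2 = triple 4 1 2 / deg 2 - triple 4 2 1 / deg 2"
    "u / deg 3 = triple 4 2 3 / deg 3 - triple 4 3 2 / deg 3"
    "u / deg 4 = triple 4 1 2 / deg 4 - triple 4 2 1 / deg 4"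
    unfolding t by (simp_all add: diff_divide_distrib add_divide_distrib)
  then have "u / deg 1 \<in> \<int>" "u / deg 2 \<in> \<int>" "u / deg 3 \<in> \<int>" "u / deg 4 \<in> \<int>"
    using ints by (metis Ints_diff insertCI)+
  then have "\<bar>u\<bar> / deg 1 \<in> \<int>" "\<bar>u\<bar> / deg 2 \<in> \<int>" "\<bar>u\<bar> / deg 3 \<in> \<int>" and u4: "\<bar>u\<bar> / deg 4 \<in> \<int>"
    using pos by (metis Ints_abs abs_divide abs_of_pos)+
  then obtain p q w where pqw: "\<bar>u\<bar> / deg 2 = of_int p" "\<bar>u\<bar> / deg 1 = of_int q" "\<bar>u\<bar> / deg 3 = of_int w"
    by (metis Ints_cases)
  obtain d where d: "deg 4 = of_int d"
    using assms unfolding integral_structure_iff by (metis Ints_cases)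
  have u0: "0 < \<bar>u\<bar>"
    using u pos by auto
  have abs_u: "\<bar>u\<bar> * \<bar>u\<bar> = deg 1 * deg 2 * deg 3"
    using u by (simp add: power2_eq_square)
  \<comment> \<open>The product of \<open>\<bar>u\<bar>\<close> over two of the degrees is the third
    degree, since the square of \<open>u\<close> is the product of all three.\<close>
  have prods: "deg 1 = of_int (p * w)" "deg 2 = of_int (q * w)" "deg 3 = of_int (p * q)"
    using pos abs_u by (simp_all add: field_simps flip: pqw)
  have "\<bar>u\<bar> = deg 3 * of_int w"
    using pos(3) by (simp flip: pqw)
  then have upqw: "\<bar>u\<bar> = of_int (p * q * w)"
    by (simp add: prods)
  have gt0: "0 < p" "0 < q" "0 < w"
    using pos u0 pqw by (metis divide_pos_pos of_int_0_less_iff)+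
  have d0: "d \<noteq> 0"
    using d pos by auto
  \<comment> \<open>The diagonal entry over \<open>deg i\<close> is \<open>(x - 1) / 2\<close>,
    which makes \<open>x\<close> odd; over \<open>deg 4\<close> it gives the divisibility by
    \<open>d\<close>.\<close>
  have "real_of_int (x - 1) / of_int 2 \<in> \<int> \<and> real_of_int (x * (x - 1)) / of_int (2 * d) \<in> \<int>"
    if "i \<in> {1, 2, 3}" "triple 4 i i = deg i * (deg i - 1) / 2" "deg i = of_int x" for i x
    using ints(1)[OF that(1) that(1)] ints(3)[OF that(1) that(1)] deg_pos[of i] that
    by (simp add: d) (auto simp: field_simps)
  then have parity: "2 dvd x - 1 \<and> 2 * d dvd x * (x - 1)"
    if "i \<in> {1, 2, 3}" "triple 4 i i = deg i * (deg i - 1) / 2" "deg i = of_int x" for i x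
    using that d0 Ints_divide_iff[of 2 "x - 1"] Ints_divide_iff[of "2 * d" "x * (x - 1)"] by auto
  have *: "odd x \<and> d dvd x * (x - 1)"
    if "i \<in> {1, 2, 3}" "triple 4 i i = deg i * (deg i - 1) / 2" "deg i = of_int x" for i x
    using parity[OF that] dvd_mult_right[of 2 d "x * (x - 1)"] by simp
  have "real_of_int (p * w + q * w + p * q) = of_int (1 + 2 * d)"
    using deg_sum_odd unfolding prods d of_int_add of_int_mult of_int_1 of_int_numeral .
  then have "p * w + q * w + p * q = 1 + 2 * d"
    by (simp only: of_int_eq_iff)
  moreover have "d dvd p * q * w"
    using u4 Ints_divide_iff[OF d0] unfolding upqw d by blast
  moreover have "odd (p * w) \<and> d dvd p * w * (p * w - 1)" "odd (q * w) \<and> d dvd q * w * (q * w - 1)"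
    "odd (p * q) \<and> d dvd p * q * (p * q - 1)"
    using *[OF _ t(1) prods(1)] *[OF _ t(2) prods(2)] *[OF _ t(3) prods(3)] by blast+
  ultimately show thesis
    using that gt0 prods d by blast
qed

text \<open>Every entry is half an integer expression. Oddness of the parameters makes the cofactors
  even, and oddness of \<open>d\<close> lets divisibility by 2 and by \<open>d\<close>
  combine.\<close>

lemma parameters_imp_integral_structure:
  fixes p q w d :: int
  assumes pos: "0 < p" "0 < q" "0 < w" and odd: "odd p" "odd q" "odd w" "odd d"
    and dvd: "d dvd p * q * w" "d dvd p * w * (p * w - 1)" "d dvd q * w * (q * w - 1)"
      "d dvd p * q * (p * q - 1)"
    and deg: "deg 1 = of_int (p * w)" "deg 2 = of_int (q * w)" "deg 3 = of_int (p * q)" "deg 4 = of_int d"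
  shows integral_structure
proof -
  obtain u where u: "u\<^sup>2 = deg 1 * deg 2 * deg 3"
    and t: "triple 4 1 1 = deg 1 * (deg 1 - 1) / 2" "triple 4 2 2 = deg 2 * (deg 2 - 1) / 2"
    "triple 4 3 3 = deg 3 * (deg 3 - 1) / 2"
    "triple 4 1 2 = (deg 1 * deg 2 + u) / 2" "triple 4 2 1 = (deg 1 * deg 2 - u) / 2"
    "triple 4 2 3 = (deg 2 * deg 3 + u) / 2" "triple 4 3 2 = (deg 2 * deg 3 - u) / 2"
    "triple 4 3 1 = (deg 1 * deg 3 + u) / 2" "triple 4 1 3 = (deg 1 * deg 3 - u) / 2"
    by (rule triple_4_parametrization)
  have "u\<^sup>2 = (of_int (p * q * w))\<^sup>2"
    unfolding u deg by (simp add: power2_eq_square)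
  then have "u = of_int (p * q * w) \<or> u = - of_int (p * q * w)"
    by (rule power2_eq_iff[THEN iffD1])
  \<comment> \<open>\<open>e\<close> is 1 or -1: the square determines \<open>u\<close> only up to
    sign, and both signs are treated together through \<open>odd e\<close>.\<close>
  then obtain e :: int where e: "odd e" and ue: "u = of_int (e * (p * q * w))"
    using that[of 1] that[of "-1"] by auto
  have d0: "d \<noteq> 0"
    using odd(4) by auto
  have two: "2 * d dvd x" if "d dvd x" "even x" for x
    using that odd(4) by (intro divides_mult) simp_all
  have diag: "2 * x dvd x * (x - 1)" "2 * d dvd x * (x - 1)" if "odd x" "d dvd x * (x - 1)" for x
    using that two[of "x * (x - 1)"] by (simp_all add: mult.commute)
  \<comment> \<open>Treats all pairs of distinct degrees at once: \<open>x = a * l\<close> and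
    \<open>y = c * l\<close> share the factor \<open>l\<close>. The cofactors
    \<open>y + s * c\<close> and \<open>x + s * a\<close> are sums of two odd numbers.\<close>
  have off: "2 * x dvd x * y + s * (p * q * w)" "2 * y dvd x * y + s * (p * q * w)"
      "2 * d dvd x * y + s * (p * q * w)"
    if "odd s" "odd a" "odd c" "odd l" "x = a * l" "y = c * l" "p * q * w = a * c * l" for x y a c l s :: int
  proof -
    have x: "x * y + s * (p * q * w) = x * (y + s * c)" and y: "x * y + s * (p * q * w) = y * (x + s * a)"
      using that(5-7) by (simp_all add: algebra_simps)
    have "even (y + s * c)" "even (x + s * a)"
      using that by simp_all
    then have "x * 2 dvd x * (y + s * c)" "y * 2 dvd y * (x + s * a)"
      by (intro mult_dvd_mono; simp)+
    then show "2 * x dvd x * y + s * (p * q * w)" "2 * y dvd x * y + s * (p * q * w)"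
      by (simp_all only: x[symmetric] y[symmetric] mult.commute[of 2])
    have "x * y = p * q * w * l"
      using that(5-7) by simp
    then have "d dvd x * y + s * (p * q * w)"
      using dvd(1) by simp
    then show "2 * d dvd x * y + s * (p * q * w)"
      by (rule two) (use x \<open>even (y + s * c)\<close> in simp)
  qed
  have frac: "real_of_int a / 2 / real_of_int c \<in> \<int>" if "2 * c dvd a" "c \<noteq> 0" for a c
    using Ints_divide_iff[of "2 * c" a] that by simp
  have nz: "p * w \<noteq> 0" "q * w \<noteq> 0" "p * q \<noteq> 0"
    using pos by simp_all
  have t': "triple 4 1 1 = of_int (p * w * (p * w - 1)) / 2"
    "triple 4 2 2 = of_int (q * w * (q * w - 1)) / 2"
    "triple 4 3 3 = of_int (p * q * (p * q - 1)) / 2"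
    "triple 4 1 2 = of_int (p * w * (q * w) + e * (p * q * w)) / 2"
    "triple 4 2 1 = of_int (p * w * (q * w) + (- e) * (p * q * w)) / 2"
    "triple 4 2 3 = of_int (q * w * (p * q) + e * (p * q * w)) / 2"
    "triple 4 3 2 = of_int (q * w * (p * q) + (- e) * (p * q * w)) / 2"
    "triple 4 3 1 = of_int (p * w * (p * q) + e * (p * q * w)) / 2"
    "triple 4 1 3 = of_int (p * w * (p * q) + (- e) * (p * q * w)) / 2"
    unfolding t deg ue by simp_all
  have off12: "2 * (p * w) dvd p * w * (q * w) + s * (p * q * w)"
    "2 * (q * w) dvd p * w * (q * w) + s * (p * q * w)"
    "2 * d dvd p * w * (q * w) + s * (p * q * w)" if "odd s" for s
    using off[of s p q w] that odd by (simp_all add: mult_ac)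
  have off23: "2 * (q * w) dvd q * w * (p * q) + s * (p * q * w)"
    "2 * (p * q) dvd q * w * (p * q) + s * (p * q * w)"
    "2 * d dvd q * w * (p * q) + s * (p * q * w)" if "odd s" for s
    using off[of s w p q] that odd by (simp_all add: mult_ac)
  have off13: "2 * (p * w) dvd p * w * (p * q) + s * (p * q * w)"
    "2 * (p * q) dvd p * w * (p * q) + s * (p * q * w)"
    "2 * d dvd p * w * (p * q) + s * (p * q * w)" if "odd s" for s
    using off[of s w q p] that odd by (simp_all add: mult_ac)
  have e': "odd (- e)"
    using e by simp
  have odds: "odd (p * w)" "odd (q * w)" "odd (p * q)"
    using odd by simp_all
  have kernel: "triple 4 4 4 / deg 4 \<in> \<int>" "triple 4 4 5 / deg 4 \<in> \<int>"
  proof -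
    have "triple 4 4 4 = of_int (d * (d + 1)) / 2" "triple 4 4 5 = of_int (d * (d - 1)) / 2"
      unfolding triple_kernel deg by (simp_all add: algebra_simps)
    moreover have "2 * d dvd d * (d + 1)" "2 * d dvd d * (d - 1)"
      using odd(4) by (simp_all add: mult.commute[of 2])
    ultimately show "triple 4 4 4 / deg 4 \<in> \<int>" "triple 4 4 5 / deg 4 \<in> \<int>"
      unfolding deg using frac d0 by presburger+
  qed
  have entry: "triple 4 i j / deg i \<in> \<int> \<and> triple 4 i j / deg j \<in> \<int> \<and> triple 4 i j / deg 4 \<in> \<int>"
    if "triple 4 i j = of_int a / 2" "deg i = of_int x" "deg j = of_int y" "x \<noteq> 0" "y \<noteq> 0"
      "2 * x dvd a" "2 * y dvd a" "2 * d dvd a" for i j a x y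
    unfolding that(1-3) deg(4) using frac that(4-) d0 by blast
  \<comment> \<open>The selection \<open>(2,1,3)\<close> exchanges the two degrees for entries
    listed in the opposite order.\<close>
  note entry[OF t'(1) deg(1,1) nz(1,1) diag(1,1,2)[OF odds(1) dvd(2)]]
    entry[OF t'(2) deg(2,2) nz(2,2) diag(1,1,2)[OF odds(2) dvd(3)]]
    entry[OF t'(3) deg(3,3) nz(3,3) diag(1,1,2)[OF odds(3) dvd(4)]]
    entry[OF t'(4) deg(1,2) nz(1,2) off12[OF e]] entry[OF t'(5) deg(2,1) nz(2,1) off12(2,1,3)[OF e']]
    entry[OF t'(6) deg(2,3) nz(2,3) off23[OF e]] entry[OF t'(7) deg(3,2) nz(3,2) off23(2,1,3)[OF e']]
    entry[OF t'(8) deg(3,1) nz(3,1) off13(2,1,3)[OF e]] entry[OF t'(9) deg(1,3) nz(1,3) off13[OF e']]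
  then have "\<forall>i\<in>{1, 2, 3}. \<forall>j\<in>{1, 2, 3}. triple 4 i j / deg i \<in> \<int> \<and> triple 4 i j / deg j \<in> \<int> \<and>
      triple 4 i j / deg 4 \<in> \<int>"
    by blast
  moreover have "deg 1 \<in> \<int>" "deg 2 \<in> \<int>" "deg 3 \<in> \<int>" "deg 4 \<in> \<int>"
    unfolding deg by simp_all
  ultimately show ?thesis
    using kernel unfolding integral_structure_iff by blast
qed

end

text \<open>\<open>d\<^sub>4\<close> names the integer value of \<open>\<delta> (b 4)\<close> that
  the divisibility conditions presuppose.\<close>

theorem theorem13:
  fixes scale :: "complex \<Rightarrow> 'a::ring_1 \<Rightarrow> 'a"
    and b :: "nat \<Rightarrow> 'a" and star :: "'a \<Rightarrow> 'a"
    and \<delta> \<phi> \<xi> :: "'a \<Rightarrow> complex" and m\<^sub>\<phi> m\<^sub>\<xi> :: real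
  assumes "nonreal_bipartite_rank_6 scale b star \<delta> \<phi> \<xi> m\<^sub>\<phi> m\<^sub>\<xi>"
  shows "based_algebra.integral_structure scale 6 b \<longleftrightarrow>
    (\<exists>\<alpha> \<gamma> k\<^sub>1 k\<^sub>2 d\<^sub>4 :: int.
       0 < \<alpha> \<and> odd \<alpha> \<and> 0 < \<gamma> \<and> odd \<gamma> \<and> 0 < k\<^sub>1 \<and> odd k\<^sub>1 \<and> 0 < k\<^sub>2 \<and> odd k\<^sub>2 \<and>
       \<delta> (b 1) = of_int (\<alpha> * \<gamma> * k\<^sub>1) \<and>
       \<delta> (b 2) = of_int (\<alpha> * \<gamma> * k\<^sub>2) \<and>
       \<delta> (b 3) = of_int (\<alpha>\<^sup>2 * k\<^sub>1 * k\<^sub>2) \<and>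
       gcd k\<^sub>1 k\<^sub>2 = 1 \<and>
       \<alpha>\<^sup>2 < 2 * \<gamma> \<and>
       \<delta> (b 4) = of_int d\<^sub>4 \<and>
       d\<^sub>4 dvd \<gamma> * k\<^sub>1 * k\<^sub>2 \<and>
       d\<^sub>4 dvd \<gamma> * k\<^sub>1 * (\<alpha> * \<gamma> * k\<^sub>1 - 1) \<and>
       d\<^sub>4 dvd \<gamma> * k\<^sub>2 * (\<alpha> * \<gamma> * k\<^sub>2 - 1) \<and>
       d\<^sub>4 dvd k\<^sub>1 * k\<^sub>2 * (\<alpha>\<^sup>2 * k\<^sub>1 * k\<^sub>2 - 1))"
  (is "_ \<longleftrightarrow> ?R")
proof -
  interpret nonreal_bipartite_rank_6 scale b star \<delta> \<phi> \<xi> m\<^sub>\<phi> m\<^sub>\<xi>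
    by (rule assms)
  have eq: "\<delta> (b i) = of_int x \<longleftrightarrow> deg i = of_int x" if "i < 6" for i x
    using degree_eq_deg[OF that] by (metis of_real_eq_iff of_real_of_int_eq)
  show ?thesis
  proof
    assume integral_structure
    then obtain p q w d :: int
      where *: "0 < p" "0 < q" "0 < w" "odd (p * w)" "odd (q * w)" "odd (p * q)"
        "p * w + q * w + p * q = 1 + 2 * d"
        "d dvd p * q * w" "d dvd p * w * (p * w - 1)" "d dvd q * w * (q * w - 1)"
        "d dvd p * q * (p * q - 1)"
      and deg: "deg 1 = of_int (p * w)" "deg 2 = of_int (q * w)" "deg 3 = of_int (p * q)"
        "deg 4 = of_int d"
      by (rule integral_structure_imp_parameters)
    have \<delta>: "\<delta> (b 1) = of_int (p * w)" "\<delta> (b 2) = of_int (q * w)" "\<delta> (b 3) = of_int (p * q)"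
      "\<delta> (b 4) = of_int d"
      using deg by (simp_all only: eq)
    show ?R
      using odd_square_products[OF *] \<delta> by metis
  next
    assume ?R
    then obtain \<alpha> \<gamma> k\<^sub>1 k\<^sub>2 d :: int
      where pos: "0 < \<alpha>" "0 < \<gamma>" "0 < k\<^sub>1" "0 < k\<^sub>2"
        and odd: "odd \<alpha>" "odd \<gamma>" "odd k\<^sub>1" "odd k\<^sub>2"
        and \<delta>: "\<delta> (b 1) = of_int (\<alpha> * \<gamma> * k\<^sub>1)" "\<delta> (b 2) = of_int (\<alpha> * \<gamma> * k\<^sub>2)"
          "\<delta> (b 3) = of_int (\<alpha>\<^sup>2 * k\<^sub>1 * k\<^sub>2)" "\<delta> (b 4) = of_int d"
        and dvd: "d dvd \<gamma> * k\<^sub>1 * k\<^sub>2" "d dvd \<gamma> * k\<^sub>1 * (\<alpha> * \<gamma> * k\<^sub>1 - 1)"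
          "d dvd \<gamma> * k\<^sub>2 * (\<alpha> * \<gamma> * k\<^sub>2 - 1)" "d dvd k\<^sub>1 * k\<^sub>2 * (\<alpha>\<^sup>2 * k\<^sub>1 * k\<^sub>2 - 1)"
      by blast
    \<comment> \<open>\<open>d\<close> divides a product of odd integers.\<close>
    have d: "odd d"
      using dvd(1) odd by (meson dvd_trans even_mult_iff)
    \<comment> \<open>Inverse substitution \<open>p = \<alpha> * k\<^sub>1\<close>,
      \<open>q = \<alpha> * k\<^sub>2\<close>, \<open>w = \<gamma>\<close>: each condition only
      gains a factor \<open>\<alpha>\<close> or its square.\<close>
    have eqs: "(\<alpha> * k\<^sub>1) * (\<alpha> * k\<^sub>2) * \<gamma> = \<alpha>\<^sup>2 * (\<gamma> * k\<^sub>1 * k\<^sub>2)"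
      "(\<alpha> * k\<^sub>1) * \<gamma> * ((\<alpha> * k\<^sub>1) * \<gamma> - 1) = \<alpha> * (\<gamma> * k\<^sub>1 * (\<alpha> * \<gamma> * k\<^sub>1 - 1))"
      "(\<alpha> * k\<^sub>2) * \<gamma> * ((\<alpha> * k\<^sub>2) * \<gamma> - 1) = \<alpha> * (\<gamma> * k\<^sub>2 * (\<alpha> * \<gamma> * k\<^sub>2 - 1))"
      "(\<alpha> * k\<^sub>1) * (\<alpha> * k\<^sub>2) * ((\<alpha> * k\<^sub>1) * (\<alpha> * k\<^sub>2) - 1)
        = \<alpha>\<^sup>2 * (k\<^sub>1 * k\<^sub>2 * (\<alpha>\<^sup>2 * k\<^sub>1 * k\<^sub>2 - 1))"
      by (simp_all add: algebra_simps power2_eq_square)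
    have "d dvd (\<alpha> * k\<^sub>1) * (\<alpha> * k\<^sub>2) * \<gamma>" "d dvd (\<alpha> * k\<^sub>1) * \<gamma> * ((\<alpha> * k\<^sub>1) * \<gamma> - 1)"
      "d dvd (\<alpha> * k\<^sub>2) * \<gamma> * ((\<alpha> * k\<^sub>2) * \<gamma> - 1)"
      "d dvd (\<alpha> * k\<^sub>1) * (\<alpha> * k\<^sub>2) * ((\<alpha> * k\<^sub>1) * (\<alpha> * k\<^sub>2) - 1)"
      unfolding eqs by (rule dvd_mult, rule dvd)+
    moreover have "deg 1 = of_int ((\<alpha> * k\<^sub>1) * \<gamma>)" "deg 2 = of_int ((\<alpha> * k\<^sub>2) * \<gamma>)"
      "deg 3 = of_int ((\<alpha> * k\<^sub>1) * (\<alpha> * k\<^sub>2))" "deg 4 = of_int d"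
    proof -
      have "deg 1 = of_int (\<alpha> * \<gamma> * k\<^sub>1)" "deg 2 = of_int (\<alpha> * \<gamma> * k\<^sub>2)"
        "deg 3 = of_int (\<alpha>\<^sup>2 * k\<^sub>1 * k\<^sub>2)" and d: "deg 4 = of_int d"
        using \<delta> by (simp_all only: eq)
      then show "deg 1 = of_int ((\<alpha> * k\<^sub>1) * \<gamma>)" "deg 2 = of_int ((\<alpha> * k\<^sub>2) * \<gamma>)"
        "deg 3 = of_int ((\<alpha> * k\<^sub>1) * (\<alpha> * k\<^sub>2))"
        by (simp_all add: power2_eq_square mult_ac)
      show "deg 4 = of_int d"
        by (rule d)
    qed
    ultimately show integral_structure
      using parameters_imp_integral_structure[of "\<alpha> * k\<^sub>1" "\<alpha> * k\<^sub>2" \<gamma> d] pos odd d by simp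
  qed
qed

end
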